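(* For every $d\ge1$ there exists a real bivariate moment matrix $M_d$ satisfying condition (G), for which there are successive extensions $M_{d+1},\ldots,M_{2d-1}$ such that: 1. for each $j$ with $d\le j\le 2d-2$, $M_{j+1}$ is the unique positive semidefinite, recursively generated moment matrix extension of $M_j$ (so the extension algorithm, started at $M_d$, determines $M_{d+1},\ldots,M_{2d-1}$); 2. the first flat extension in this sequence occurs at $M_{2d-1}$, i.e., $\operatorname{rank}M_{2d-1}=\operatorname{rank}M_{2d-2}$, while $\operatorname{rank}M_{j}>\operatorname{rank}M_{j-1}$ for $d+1\le j\le 2d-2$; 3. each $M_{d+i}$ ($0\le i\le d-1$) satisfies condition (G) (so that $M_{d+i}$ has a unique $RG$ extension $M_{d+i+1}$, and to continue the sequence it is only necessary to verify that this $RG$ extension is positive semidefinite).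
   Context: $\mathcal P_k$ is the space of real polynomials in $x,y$ of total degree at most $k$; for $f\in\mathcal P_k$, $\hat f$ is its coefficient vector with respect to the monomials in degree-lexicographic order. For a real sequence $\beta=\{\beta_{ij}\}_{i,j\ge0,\,i+j\le 2k}$, the moment matrix $M_k=M_k(\beta)$ has rows and columns indexed by the monomials of degree at most $k$ (denoted $1,X,Y,\ldots,X^k,\ldots,Y^k$), and the entry in row $X^iY^j$, column $X^sY^t$ is $\beta_{i+s,j+t}$. For $f=\sum a_{ij}x^iy^j\in\mathcal P_k$, $f(X,Y):=\sum a_{ij}X^iY^j=M_k\hat f$. $M_k$ is recursively generated if $f,g,fg\in\mathcal P_k$ and $f(X,Y)=0$ imply $(fg)(X,Y)=0$. A moment matrix extension $M_{k+1}=\begin{pmatrix} M_k & B(k+1)\\ B(k+1)^T & C(k+1)\end{pmatrix}$ is the moment matrix of a real sequence of degree $2k+2$ extending $\beta$. $M_{k-1}$ denotes the compression of $M_k$ to rows and columns of degree at most $k-1$. $M_{k+1}$ is an $RG$ extension of $M_k$ if $M_k$ is positive semidefinite, $\operatorname{Ran}B(k+1)\subseteq\operatorname{Ran}M_k$, each dependence relation in the column space of $M_k$ also holds among the corresponding columns of $M_{k+1}$, and $M_{k+1}$ is recursively generated. Condition (G) for $M_k$: $M_k$ is positive semidefinite and there are integers $1\le n,m\le k$, $p\in\mathcal P_{n-1}$, and $q\in\mathcal P_m$ all of whose terms $x^uy^v$ satisfy $v<m$, such that all column dependence relations of $M_k$ are generated by $X^n=p(X,Y)$ and $Y^m=q(X,Y)$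 via recursiveness and linearity; that is, $\ker M_k$ is exactly the span of the vectors $\widehat{x^iy^j(x^n-p)}$ ($i,j\ge0$, $i+j+n\le k$) and $\widehat{x^iy^j(y^m-q)}$ ($i,j\ge0$, $i+j+m\le k$). The extension algorithm: given $M_k$ with column relations $X^n=p(X,Y)$, $Y^m=q(X,Y)$, where $1\le n,m\le k$, $p\in\mathcal P_{n-1}$, and $q\in\mathcal P_m$ has only terms $x^uy^v$ with $v<m$, any positive semidefinite recursively generated extension $M_{k+1}$ must satisfy $X^{n+f}Y^{k+1-n-f}=(x^fy^{k+1-n-f}p)(X,Y)$ and $X^{k+1-m-g}Y^{m+g}=(x^{k+1-m-g}y^gq)(X,Y)$, which determine it uniquely; the algorithm constructs this unique candidate, checks whether it is a well-defined positive semidefinite recursively generated extension, and iterates. *)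

theory Defs
  imports
    "HOL-Library.Poly_Mapping"
    "HOL-Library.Product_Plus"
    "Jordan_Normal_Form.Matrix_Kernel"
    "Jordan_Normal_Form.DL_Rank"
begin

(* R[x,y] as the monoid algebra of nat x nat: the key (i,j) stands for x^i y^j, and the
   ring product of finitely supported functions is the product of polynomials. *)
type_synonym bipoly = "(nat \<times> nat) \<Rightarrow>\<^sub>0 real"

definition xy :: "nat \<Rightarrow> nat \<Rightarrow> bipoly" where
  "xy i j = Poly_Mapping.single (i, j) 1"

definition polys_upto :: "nat \<Rightarrow> bipoly set" where
  "polys_upto k = {f. \<forall>(i, j) \<in> Poly_Mapping.keys f. i + j \<le> k}"

(* Degree-lexicographic order 1, x, y, x^2, xy, y^2, ...; the list for k is a prefix of the
   list for Suc k. *)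
definition monomials :: "nat \<Rightarrow> (nat \<times> nat) list" where
  "monomials k = concat (map (\<lambda>t. map (\<lambda>j. (t - j, j)) [0..<Suc t]) [0..<Suc k])"

definition mdim :: "nat \<Rightarrow> nat" where
  "mdim k = length (monomials k)"

definition coeff_vec :: "nat \<Rightarrow> bipoly \<Rightarrow> real vec" where
  "coeff_vec k f = vec (mdim k) (\<lambda>r. Poly_Mapping.lookup f (monomials k ! r))"

(* A sequence is given by a total function of the exponent pair; only its values at pairs of
   sum at most 2 * k enter. Exponent pairs are added componentwise. *)
definition moment_matrix :: "nat \<Rightarrow> (nat \<times> nat \<Rightarrow> real) \<Rightarrow> real mat" where
  "moment_matrix k \<beta> =
     mat (mdim k) (mdim k) (\<lambda>(r, c). \<beta> (monomials k ! r + monomials k ! c))"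

definition psd :: "real mat \<Rightarrow> bool" where
  "psd A \<longleftrightarrow> A \<in> carrier_mat (dim_row A) (dim_row A) \<and> transpose_mat A = A \<and>
     (\<forall>v \<in> carrier_vec (dim_row A). 0 \<le> v \<bullet> (A *\<^sub>v v))"

definition mat_rank :: "real mat \<Rightarrow> nat" where
  "mat_rank A = vec_space.rank (dim_row A) A"

definition vspan :: "nat \<Rightarrow> real vec set \<Rightarrow> real vec set" where
  "vspan n S = LinearCombinations.module.span class_ring (module_vec TYPE(real) n) S"

definition mat_range :: "real mat \<Rightarrow> real vec set" where
  "mat_range A = vspan (dim_row A) (set (cols A))"

(* The column combination f(X,Y). *)
definition poly_col :: "nat \<Rightarrow> real mat \<Rightarrow> bipoly \<Rightarrow> real vec" where
  "poly_col k M f = M *\<^sub>v coeff_vec k f"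

definition recursively_generated :: "nat \<Rightarrow> real mat \<Rightarrow> bool" where
  "recursively_generated k M \<longleftrightarrow>
     (\<forall>f g. f \<in> polys_upto k \<longrightarrow> g \<in> polys_upto k \<longrightarrow> f * g \<in> polys_upto k \<longrightarrow>
        poly_col k M f = 0\<^sub>v (mdim k) \<longrightarrow> poly_col k M (f * g) = 0\<^sub>v (mdim k))"

definition moment_extension :: "nat \<Rightarrow> real mat \<Rightarrow> real mat \<Rightarrow> bool" where
  "moment_extension k M N \<longleftrightarrow>
     (\<exists>\<gamma>. M = moment_matrix k \<gamma> \<and> N = moment_matrix (Suc k) \<gamma>)"

(* The upper right block B(k+1) of N = M_(k+1): rows of degree at most k, columns of degree k+1. *)
definition block_B :: "nat \<Rightarrow> real mat \<Rightarrow> real mat" where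
  "block_B k N = mat (mdim k) (mdim (Suc k) - mdim k) (\<lambda>(r, c). N $$ (r, mdim k + c))"

definition RG_extension :: "nat \<Rightarrow> real mat \<Rightarrow> real mat \<Rightarrow> bool" where
  "RG_extension k M N \<longleftrightarrow>
     moment_extension k M N \<and> psd M \<and> mat_range (block_B k N) \<subseteq> mat_range M \<and>
     (\<forall>f \<in> polys_upto k. poly_col k M f = 0\<^sub>v (mdim k) \<longrightarrow>
        poly_col (Suc k) N f = 0\<^sub>v (mdim (Suc k))) \<and>
     recursively_generated (Suc k) N"

definition psd_RG_moment_extension :: "nat \<Rightarrow> real mat \<Rightarrow> real mat \<Rightarrow> bool" where
  "psd_RG_moment_extension k M N \<longleftrightarrow>
     moment_extension k M N \<and> psd N \<and> recursively_generated (Suc k) N"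

(* The admissible shapes of the two relations X^n = p(X,Y) and Y^m = q(X,Y). *)
definition relation_shape ::
    "nat \<Rightarrow> nat \<Rightarrow> nat \<Rightarrow> bipoly \<Rightarrow> bipoly \<Rightarrow> bool" where
  "relation_shape k n m p q \<longleftrightarrow>
     1 \<le> n \<and> n \<le> k \<and> 1 \<le> m \<and> m \<le> k \<and> p \<in> polys_upto (n - 1) \<and>
     q \<in> polys_upto m \<and> (\<forall>(u, v) \<in> Poly_Mapping.keys q. v < m)"

definition G_generated ::
    "nat \<Rightarrow> nat \<Rightarrow> nat \<Rightarrow> bipoly \<Rightarrow> bipoly \<Rightarrow> real mat \<Rightarrow> bool" where
  "G_generated k n m p q M \<longleftrightarrow>
     psd M \<and> relation_shape k n m p q \<and>
     mat_kernel M = vspan (mdim k)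
       ({coeff_vec k (xy i j * (xy n 0 - p)) | i j. i + j + n \<le> k} \<union>
        {coeff_vec k (xy i j * (xy 0 m - q)) | i j. i + j + m \<le> k})"

definition condition_G :: "nat \<Rightarrow> real mat \<Rightarrow> bool" where
  "condition_G k M \<longleftrightarrow> (\<exists>n m p q. G_generated k n m p q M)"

(* N is an extension satisfying the column relations that every positive semidefinite recursively
   generated extension of M is forced to satisfy. *)
definition algorithm_candidate ::
    "nat \<Rightarrow> nat \<Rightarrow> nat \<Rightarrow> bipoly \<Rightarrow> bipoly \<Rightarrow> real mat \<Rightarrow> real mat \<Rightarrow> bool" where
  "algorithm_candidate k n m p q M N \<longleftrightarrow>
     moment_extension k M N \<and>
     (\<forall>f. n + f \<le> k + 1 \<longrightarrow>
        poly_col (Suc k) N (xy (n + f) (k + 1 - n - f)) =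
        poly_col (Suc k) N (xy f (k + 1 - n - f) * p)) \<and>
     (\<forall>g. m + g \<le> k + 1 \<longrightarrow>
        poly_col (Suc k) N (xy (k + 1 - m - g) (m + g)) =
        poly_col (Suc k) N (xy (k + 1 - m - g) g * q))"

(* One successful step of the extension algorithm, from input M to output N. *)
definition algorithm_step ::
    "nat \<Rightarrow> nat \<Rightarrow> nat \<Rightarrow> bipoly \<Rightarrow> bipoly \<Rightarrow> real mat \<Rightarrow> real mat \<Rightarrow> bool" where
  "algorithm_step k n m p q M N \<longleftrightarrow>
     relation_shape k n m p q \<and>
     poly_col k M (xy n 0) = poly_col k M p \<and>
     poly_col k M (xy 0 m) = poly_col k M q \<and>
     (\<forall>N'. algorithm_candidate k n m p q M N' \<longleftrightarrow> N' = N) \<and>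
     psd N \<and> recursively_generated (Suc k) N"

end

theory Submission
  imports Defs
begin

text \<open>Take for \<open>\<beta>\<close> the moments of the counting measure on the grid \<open>{0..<d} \<times> {0..<d}\<close>. Then \<open>M\<^sub>k\<close> is
  the Gram matrix of the evaluations on the grid, so its kernel consists of the polynomials of degree at
  most \<open>k\<close> vanishing there. Writing \<open>x\<^sup>d\<close> as a polynomial of degree less than \<open>d\<close> on
  \<open>{0..<d}\<close> gives relations \<open>X\<^sup>d = p(X)\<close> and \<open>Y\<^sup>d = p(Y)\<close>; their leading terms are coprime, so
  division with remainder shows that they generate the kernel in each degree, and that the rank of
  \<open>M\<^sub>k\<close> is the number of monomials \<open>x\<^sup>iy\<^sup>j\<close> with \<open>i, j < d\<close> and \<open>i + j \<le> k\<close>. This number grows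
  strictly until \<open>k = 2d - 2\<close> and is constant afterwards.

  For any relations \<open>X\<^sup>n = p\<close>, \<open>Y\<^sup>m = q\<close> with \<open>n, m \<le> k\<close>, a monomial \<open>x\<^sup>uy\<^sup>v\<close> of degree greater
  than \<open>2k\<close> has \<open>u \<ge> n\<close> or \<open>v \<ge> m\<close>. Hence the relations determine every moment of degree \<open>2k + 1\<close> and \<open>2k + 2\<close>, by induction on the degree and then on
  the \<open>y\<close>-exponent, although they need not determine the columns of degree \<open>k + 1\<close> individually as
  combinations of earlier ones.\<close>

section \<open>Polynomials and moment matrices\<close>

lemma bipoly_expand:
  "f = (\<Sum>k\<in>Poly_Mapping.keys f. Poly_Mapping.single k (Poly_Mapping.lookup f k))"
  by (rule poly_mapping_eqI)
     (simp add: lookup_sum lookup_single when_def in_keys_iff)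

text \<open>Scalar multiples are written throughout as products with the constant polynomial
  \<open>Poly_Mapping.single 0 c\<close>; this rule turns them into multiples of
  coefficients.\<close>

lemma lookup_const_mult [simp]:
  fixes f :: bipoly
  shows "Poly_Mapping.lookup (Poly_Mapping.single 0 c * f) k = c * Poly_Mapping.lookup f k"
proof -
  have "Poly_Mapping.lookup (Poly_Mapping.single 0 c * f) k =
      Poly_Mapping.lookup (\<Sum>l\<in>Poly_Mapping.keys f.
        Poly_Mapping.single 0 c * Poly_Mapping.single l (Poly_Mapping.lookup f l)) k"
    by (subst bipoly_expand [of f]) (simp add: sum_distrib_left)
  also have "\<dots> = c * Poly_Mapping.lookup f k"
    by (simp add: mult_single lookup_sum lookup_single when_def in_keys_iff)
  finally show ?thesis .
qed

text \<open>Reduces additive identities between polynomials to single terms, where they become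
  computations with exponents.\<close>

lemma bipoly_induct [case_names zero add single]:
  fixes f :: bipoly
  assumes "P 0" and "\<And>f g. P f \<Longrightarrow> P g \<Longrightarrow> P (f + g)"
    and "\<And>k c. P (Poly_Mapping.single k c)"
  shows "P f"
proof -
  have "P (\<Sum>k\<in>K. Poly_Mapping.single k (Poly_Mapping.lookup f k))" if "finite K" for K
    using that by (induction K rule: finite_induct) (auto intro: assms)
  then show ?thesis
    by (metis bipoly_expand finite_keys)
qed

lemma xy_mult: "xy a b * xy u v = xy (a + u) (b + v)"
  by (simp add: xy_def mult_single)

lemma keys_xy [simp]: "Poly_Mapping.keys (xy a b) = {(a, b)}"
  by (simp add: xy_def)

lemma lookup_xy: "Poly_Mapping.lookup (xy a b) k = (if k = (a, b) then 1 else 0)"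
  by (auto simp: xy_def lookup_single when_def)

lemma lookup_xy_mult:
  "Poly_Mapping.lookup (xy a b * f) (u, v) =
     (if a \<le> u \<and> b \<le> v then Poly_Mapping.lookup f (u - a, v - b) else 0)"
proof (induction f rule: bipoly_induct)
  case (single k c)
  then show ?case
    by (cases k) (auto simp: xy_def mult_single lookup_single when_def)
qed (auto simp: lookup_add distrib_left)

lemma keys_xy_mult: "Poly_Mapping.keys (xy a b * f) = (\<lambda>(u, v). (a + u, b + v)) ` Poly_Mapping.keys f"
proof (rule Set.set_eqI)
  fix k :: "nat \<times> nat"
  obtain u v where k: "k = (u, v)" by fastforce
  show "k \<in> Poly_Mapping.keys (xy a b * f) \<longleftrightarrow> k \<in> (\<lambda>(u, v). (a + u, b + v)) ` Poly_Mapping.keys f"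
    unfolding k by (force simp: in_keys_iff lookup_xy_mult image_iff split: if_splits)
qed

lemma polys_upto_iff: "f \<in> polys_upto k \<longleftrightarrow> (\<forall>i j. (i, j) \<in> Poly_Mapping.keys f \<longrightarrow> i + j \<le> k)"
  by (auto simp: polys_upto_def)

lemma polys_upto_mono: "f \<in> polys_upto k \<Longrightarrow> k \<le> l \<Longrightarrow> f \<in> polys_upto l"
  by (fastforce simp: polys_upto_iff)

lemma polys_upto_add: "f \<in> polys_upto k \<Longrightarrow> g \<in> polys_upto k \<Longrightarrow> f + g \<in> polys_upto k"
  unfolding polys_upto_iff using keys_add [of f g] by blast

lemma polys_upto_const_mult: "f \<in> polys_upto k \<Longrightarrow> Poly_Mapping.single 0 c * f \<in> polys_upto k"
  by (auto simp: polys_upto_iff in_keys_iff)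

lemma polys_upto_diff: "f \<in> polys_upto k \<Longrightarrow> g \<in> polys_upto k \<Longrightarrow> f - g \<in> polys_upto k"
  unfolding polys_upto_iff using keys_diff [of f g] by blast

lemma polys_upto_zero [simp]: "0 \<in> polys_upto k"
  by (simp add: polys_upto_iff)

lemma polys_upto_sum: "(\<And>i. i \<in> I \<Longrightarrow> f i \<in> polys_upto k) \<Longrightarrow> (\<Sum>i\<in>I. f i) \<in> polys_upto k"
  by (induction I rule: infinite_finite_induct) (auto intro: polys_upto_add)

lemma xy_in_polys_upto [simp]: "xy a b \<in> polys_upto k \<longleftrightarrow> a + b \<le> k"
  by (auto simp: polys_upto_iff)

lemma polys_upto_xy_mult: "f \<in> polys_upto k \<Longrightarrow> xy a b * f \<in> polys_upto (a + b + k)"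
  by (fastforce simp: polys_upto_iff keys_xy_mult)

section \<open>The Riesz functional of a moment sequence\<close>

definition riesz :: "(nat \<times> nat \<Rightarrow> real) \<Rightarrow> bipoly \<Rightarrow> real" where
  "riesz \<beta> f = (\<Sum>k\<in>Poly_Mapping.keys f. Poly_Mapping.lookup f k * \<beta> k)"

text \<open>Cancellation can make the support of a sum smaller than the union of the supports; a
  common finite index set avoids this in the proof of additivity.\<close>

lemma riesz_superset:
  assumes "finite S" "Poly_Mapping.keys f \<subseteq> S"
  shows "riesz \<beta> f = (\<Sum>k\<in>S. Poly_Mapping.lookup f k * \<beta> k)"
  unfolding riesz_def using assms by (intro sum.mono_neutral_left) (auto simp: in_keys_iff)

lemma riesz_add: "riesz \<beta> (f + g) = riesz \<beta> f + riesz \<beta> g"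
proof -
  let ?S = "Poly_Mapping.keys f \<union> Poly_Mapping.keys g"
  have "Poly_Mapping.keys (f + g) \<subseteq> ?S" by (rule keys_add)
  then show ?thesis
    by (simp add: riesz_superset [of ?S] lookup_add distrib_right sum.distrib)
qed

lemma riesz_zero [simp]: "riesz \<beta> 0 = 0"
  by (simp add: riesz_def)

lemma riesz_single [simp]: "riesz \<beta> (Poly_Mapping.single k c) = c * \<beta> k"
  by (simp add: riesz_def)

lemma riesz_xy [simp]: "riesz \<beta> (xy a b) = \<beta> (a, b)"
  by (simp add: xy_def)

lemma riesz_diff: "riesz \<beta> (f - g) = riesz \<beta> f - riesz \<beta> g"
  using riesz_add [of \<beta> "f - g" g] by simp

lemma riesz_sum: "riesz \<beta> (\<Sum>i\<in>I. f i) = (\<Sum>i\<in>I. riesz \<beta> (f i))"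
  by (induction I rule: infinite_finite_induct) (auto simp: riesz_add)

lemma riesz_const_mult: "riesz \<beta> (Poly_Mapping.single 0 c * f) = c * riesz \<beta> f"
proof (induction f rule: bipoly_induct)
  case (single k c)
  then show ?case by (simp add: mult_single)
qed (auto simp: riesz_add distrib_left)

lemma riesz_cong:
  "(\<And>k. k \<in> Poly_Mapping.keys f \<Longrightarrow> \<beta> k = \<gamma> k) \<Longrightarrow> riesz \<beta> f = riesz \<gamma> f"
  by (simp add: riesz_def)

text \<open>Expanding \<open>f\<close> into its terms writes the value as a linear combination of
  the assumed zeros. The version with the exact support serves orthogonality to a given set of
  monomials, the next one a degree bound.\<close>

lemma riesz_mult_eq_0_keys:
  assumes "\<And>z. z \<in> Poly_Mapping.keys f \<Longrightarrow> riesz \<beta> (xy (fst z) (snd z) * g) = 0"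
  shows "riesz \<beta> (f * g) = 0"
proof -
  have "f * g = (\<Sum>z\<in>Poly_Mapping.keys f.
      Poly_Mapping.single 0 (Poly_Mapping.lookup f z) * (xy (fst z) (snd z) * g))"
    by (subst bipoly_expand [of f])
      (simp add: sum_distrib_right xy_def mult_single flip: mult.assoc)
  then show ?thesis
    using assms by (simp add: riesz_sum riesz_const_mult)
qed

lemma riesz_mult_eq_0:
  assumes "f \<in> polys_upto k" and "\<And>a b. a + b \<le> k \<Longrightarrow> riesz \<beta> (xy a b * g) = 0"
  shows "riesz \<beta> (f * g) = 0"
  by (rule riesz_mult_eq_0_keys) (use assms in \<open>auto simp: polys_upto_iff\<close>)

section \<open>Enumeration of monomials and coefficient vectors\<close>

lemma set_monomials: "set (monomials k) = {(i, j). i + j \<le> k}"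
proof -
  have "set (monomials k) = (\<Union>t\<in>{..k}. (\<lambda>j. (t - j, j)) ` {..t})"
    by (simp add: monomials_def atLeast0LessThan lessThan_Suc_atMost del: upt_Suc)
  also have "\<dots> = {(i, j). i + j \<le> k}"
  proof (intro equalityI subsetI)
    fix z assume "z \<in> {(i, j). i + j \<le> k}"
    then show "z \<in> (\<Union>t\<in>{..k}. (\<lambda>j. (t - j, j)) ` {..t})"
      by (intro UN_I [of "fst z + snd z"] image_eqI [of _ _ "snd z"]) auto
  qed auto
  finally show ?thesis .
qed

lemma monomials_Suc:
  "monomials (Suc k) = monomials k @ map (\<lambda>j. (Suc k - j, j)) [0..<Suc (Suc k)]"
  by (simp add: monomials_def)

lemma distinct_monomials: "distinct (monomials k)"
proof (induction k)
  case 0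
  then show ?case by (simp add: monomials_def)
next
  case (Suc k)
  have "(a, b) \<notin> (\<lambda>j. (Suc k - j, j)) ` {0..<Suc (Suc k)}" if "a + b \<le> k" for a b
    using that by auto
  then show ?case
    using Suc by (auto simp: monomials_Suc set_monomials distinct_map inj_on_def simp del: upt_Suc)
qed

lemma nth_monomials_Suc: "r < mdim k \<Longrightarrow> monomials (Suc k) ! r = monomials k ! r"
  by (simp add: monomials_Suc mdim_def nth_append)

lemma mdim_le_Suc: "mdim k \<le> mdim (Suc k)"
  by (simp add: monomials_Suc mdim_def)

lemma nth_monomials_degree: "r < mdim k \<Longrightarrow> fst (monomials k ! r) + snd (monomials k ! r) \<le> k"
  using nth_mem [of r "monomials k"] by (auto simp: mdim_def set_monomials case_prod_beta)

lemma monomials_index: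
  assumes "a + b \<le> k"
  obtains r where "r < mdim k" "monomials k ! r = (a, b)"
proof -
  have "(a, b) \<in> set (monomials k)" using assms by (simp add: set_monomials)
  then show ?thesis using that by (auto simp: in_set_conv_nth mdim_def)
qed

lemma bij_betw_monomials: "bij_betw ((!) (monomials k)) {..<mdim k} {(i, j). i + j \<le> k}"
  using bij_betw_nth [OF distinct_monomials, of "{..<mdim k}" k] set_monomials [of k]
  by (simp add: mdim_def)

lemma finite_degree_le: "finite {(i, j). i + j \<le> (k::nat)}"
  using set_monomials [of k] by (metis List.finite_set)

text \<open>A right inverse of \<open>coeff_vec k\<close> on vectors of length
  \<open>mdim k\<close>, which turns statements about all vectors into statements about
  \<open>polys_upto k\<close>.\<close>

definition poly_of_vec :: "nat \<Rightarrow> real vec \<Rightarrow> bipoly" where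
  "poly_of_vec k v = (\<Sum>r<mdim k. Poly_Mapping.single (monomials k ! r) (v $ r))"

lemma poly_of_vec_in_polys_upto: "poly_of_vec k v \<in> polys_upto k"
proof -
  have "Poly_Mapping.single (monomials k ! r) c \<in> polys_upto k" if "r < mdim k" for r c
    using nth_monomials_degree [OF that] by (auto simp: polys_upto_def)
  then show ?thesis by (auto simp: poly_of_vec_def intro: polys_upto_sum)
qed

lemma coeff_vec_carrier [simp]: "coeff_vec k f \<in> carrier_vec (mdim k)"
  by (simp add: coeff_vec_def)

lemma dim_coeff_vec [simp]: "dim_vec (coeff_vec k f) = mdim k"
  by (simp add: coeff_vec_def)

lemma nth_monomials_eq_iff: "r < mdim k \<Longrightarrow> s < mdim k \<Longrightarrow> monomials k ! r = monomials k ! s \<longleftrightarrow> r = s"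
  by (simp add: mdim_def nth_eq_iff_index_eq distinct_monomials)

lemma lookup_poly_of_vec:
  assumes "r < mdim k"
  shows "Poly_Mapping.lookup (poly_of_vec k v) (monomials k ! r) = v $ r"
proof -
  have "Poly_Mapping.lookup (poly_of_vec k v) (monomials k ! r) =
      (\<Sum>s<mdim k. if s = r then v $ s else 0)"
    using assms
    by (auto simp: poly_of_vec_def lookup_sum lookup_single when_def nth_monomials_eq_iff
        intro!: sum.cong)
  then show ?thesis using assms by simp
qed

lemma coeff_vec_poly_of_vec: "v \<in> carrier_vec (mdim k) \<Longrightarrow> coeff_vec k (poly_of_vec k v) = v"
  by (intro eq_vecI) (auto simp: coeff_vec_def lookup_poly_of_vec)

lemma coeff_vec_add: "coeff_vec k (f + g) = coeff_vec k f + coeff_vec k g"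
  by (intro eq_vecI) (auto simp: coeff_vec_def lookup_add)

lemma coeff_vec_const_mult: "coeff_vec k (Poly_Mapping.single 0 c * f) = c \<cdot>\<^sub>v coeff_vec k f"
  by (intro eq_vecI) (auto simp: coeff_vec_def)

lemma coeff_vec_zero [simp]: "coeff_vec k 0 = 0\<^sub>v (mdim k)"
  by (intro eq_vecI) (auto simp: coeff_vec_def)

text \<open>Positions correspond bijectively to monomials of degree at most \<open>k\<close>, and
  the degree bound on \<open>f\<close> ensures that \<open>coeff_vec k\<close> drops no
  term.\<close>

lemma sum_coeff_vec:
  assumes "f \<in> polys_upto k"
  shows "(\<Sum>r<mdim k. coeff_vec k f $ r * F (monomials k ! r)) =
    (\<Sum>z\<in>Poly_Mapping.keys f. Poly_Mapping.lookup f z * F z)"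
proof -
  have "(\<Sum>r<mdim k. coeff_vec k f $ r * F (monomials k ! r)) =
      (\<Sum>r<mdim k. Poly_Mapping.lookup f (monomials k ! r) * F (monomials k ! r))"
    by (simp add: coeff_vec_def)
  also have "\<dots> = (\<Sum>z\<in>{(i, j). i + j \<le> k}. Poly_Mapping.lookup f z * F z)"
    by (rule sum.reindex_bij_betw [OF bij_betw_monomials])
  also have "\<dots> = (\<Sum>z\<in>Poly_Mapping.keys f. Poly_Mapping.lookup f z * F z)"
    using assms finite_degree_le [of k]
    by (intro sum.mono_neutral_right) (auto simp: polys_upto_iff in_keys_iff)
  finally show ?thesis .
qed

section \<open>Columns and quadratic form of a moment matrix\<close>

lemma moment_matrix_carrier [simp]: "moment_matrix k \<beta> \<in> carrier_mat (mdim k) (mdim k)"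
  by (simp add: moment_matrix_def)

lemma dim_moment_matrix [simp]:
  "dim_row (moment_matrix k \<beta>) = mdim k" "dim_col (moment_matrix k \<beta>) = mdim k"
  by (simp_all add: moment_matrix_def)

lemma dim_poly_col [simp]: "dim_vec (poly_col k (moment_matrix k \<beta>) f) = mdim k"
  by (simp add: poly_col_def)

lemma riesz_xy_mult: "riesz \<beta> (xy a b * f) = (\<Sum>z\<in>Poly_Mapping.keys f. Poly_Mapping.lookup f z * \<beta> ((a, b) + z))"
proof -
  have "riesz \<beta> (xy a b * f) = riesz \<beta> (\<Sum>z\<in>Poly_Mapping.keys f.
      xy a b * Poly_Mapping.single z (Poly_Mapping.lookup f z))"
    by (subst bipoly_expand [of f]) (simp add: sum_distrib_left)
  then show ?thesis by (simp add: riesz_sum xy_def mult_single)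
qed

text \<open>The bridge from matrices to polynomials: through it column relations become identities
  for \<open>riesz \<beta>\<close>, free of matrix indices.\<close>

lemma poly_col_nth:
  assumes "f \<in> polys_upto k" "r < mdim k" "monomials k ! r = (a, b)"
  shows "poly_col k (moment_matrix k \<beta>) f $ r = riesz \<beta> (xy a b * f)"
proof -
  have "poly_col k (moment_matrix k \<beta>) f $ r =
      (\<Sum>c<mdim k. coeff_vec k f $ c * \<beta> ((a, b) + monomials k ! c))"
    using assms(2,3)
    by (simp add: poly_col_def moment_matrix_def scalar_prod_def atLeast0LessThan mult.commute)
  then show ?thesis
    using sum_coeff_vec [OF assms(1), of "\<lambda>z. \<beta> ((a, b) + z)"] by (simp add: riesz_xy_mult)
qed

lemma poly_col_eq_iff:
  assumes "f \<in> polys_upto k" "g \<in> polys_upto k"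
  shows "poly_col k (moment_matrix k \<beta>) f = poly_col k (moment_matrix k \<beta>) g \<longleftrightarrow>
    (\<forall>a b. a + b \<le> k \<longrightarrow> riesz \<beta> (xy a b * f) = riesz \<beta> (xy a b * g))"
proof
  assume *: "poly_col k (moment_matrix k \<beta>) f = poly_col k (moment_matrix k \<beta>) g"
  show "\<forall>a b. a + b \<le> k \<longrightarrow> riesz \<beta> (xy a b * f) = riesz \<beta> (xy a b * g)"
    by (metis * assms monomials_index poly_col_nth)
next
  assume *: "\<forall>a b. a + b \<le> k \<longrightarrow> riesz \<beta> (xy a b * f) = riesz \<beta> (xy a b * g)"
  show "poly_col k (moment_matrix k \<beta>) f = poly_col k (moment_matrix k \<beta>) g"
  proof (rule eq_vecI)
    fix r assume "r < dim_vec (poly_col k (moment_matrix k \<beta>) g)"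
    then have r: "r < mdim k" by simp
    obtain a b where ab: "monomials k ! r = (a, b)" by fastforce
    show "poly_col k (moment_matrix k \<beta>) f $ r = poly_col k (moment_matrix k \<beta>) g $ r"
      using * nth_monomials_degree [OF r] by (simp add: poly_col_nth [OF _ r ab] assms ab)
  qed simp
qed

lemma poly_col_zero: "poly_col k (moment_matrix k \<beta>) 0 = 0\<^sub>v (mdim k)"
  by (intro eq_vecI) (auto simp: poly_col_def)

lemma poly_col_eq_0_iff:
  assumes "f \<in> polys_upto k"
  shows "poly_col k (moment_matrix k \<beta>) f = 0\<^sub>v (mdim k) \<longleftrightarrow>
    (\<forall>a b. a + b \<le> k \<longrightarrow> riesz \<beta> (xy a b * f) = 0)"
  using poly_col_eq_iff [OF assms polys_upto_zero, of \<beta>] by (simp add: poly_col_zero)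

lemma scalar_prod_poly_col:
  assumes "f \<in> polys_upto k" "g \<in> polys_upto k"
  shows "coeff_vec k f \<bullet> poly_col k (moment_matrix k \<beta>) g = riesz \<beta> (f * g)"
proof -
  have "coeff_vec k f \<bullet> poly_col k (moment_matrix k \<beta>) g = (\<Sum>r<mdim k. coeff_vec k f $ r *
      riesz \<beta> (xy (fst (monomials k ! r)) (snd (monomials k ! r)) * g))"
    by (auto simp: scalar_prod_def atLeast0LessThan poly_col_nth [OF assms(2)] intro!: sum.cong)
  also have "\<dots> = (\<Sum>z\<in>Poly_Mapping.keys f. Poly_Mapping.lookup f z *
      riesz \<beta> (xy (fst z) (snd z) * g))"
    by (rule sum_coeff_vec [OF assms(1)])
  also have "\<dots> = riesz \<beta> (\<Sum>z\<in>Poly_Mapping.keys f.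
      Poly_Mapping.single 0 (Poly_Mapping.lookup f z) * (xy (fst z) (snd z) * g))"
    by (simp add: riesz_sum riesz_const_mult)
  also have "(\<Sum>z\<in>Poly_Mapping.keys f.
      Poly_Mapping.single 0 (Poly_Mapping.lookup f z) * (xy (fst z) (snd z) * g)) = f * g"
    (is "?S = _")
  proof -
    have "f * g = ?S"
      by (subst bipoly_expand [of f])
        (simp add: sum_distrib_right xy_def mult_single flip: mult.assoc)
    then show ?thesis by simp
  qed
  finally show ?thesis .
qed

text \<open>Every vector is the coefficient vector of a polynomial of degree at most
  \<open>k\<close>, so testing the quadratic form means testing squares.\<close>

lemma psd_moment_matrix_iff:
  "psd (moment_matrix k \<beta>) \<longleftrightarrow> (\<forall>f\<in>polys_upto k. 0 \<le> riesz \<beta> (f * f))"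
proof -
  have "transpose_mat (moment_matrix k \<beta>) = moment_matrix k \<beta>"
    by (auto simp: moment_matrix_def add.commute)
  then have "psd (moment_matrix k \<beta>) \<longleftrightarrow>
      (\<forall>v\<in>carrier_vec (mdim k). 0 \<le> v \<bullet> (moment_matrix k \<beta> *\<^sub>v v))"
    by (simp add: psd_def)
  also have "\<dots> \<longleftrightarrow> (\<forall>f\<in>polys_upto k. 0 \<le> coeff_vec k f \<bullet> poly_col k (moment_matrix k \<beta>) f)"
    unfolding poly_col_def
    by (metis coeff_vec_carrier coeff_vec_poly_of_vec poly_of_vec_in_polys_upto)
  finally show ?thesis
    by (simp add: scalar_prod_poly_col)
qed

text \<open>The degenerate case of Cauchy-Schwarz: along \<open>g + c f\<close> the quadratic form
  is affine in \<open>c\<close>, and a nonconstant affine function takes negative values.\<close>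

lemma riesz_psd_null:
  assumes psd: "psd (moment_matrix k \<beta>)" and "f \<in> polys_upto k" "g \<in> polys_upto k"
    and "riesz \<beta> (f * f) = 0"
  shows "riesz \<beta> (g * f) = 0"
proof (rule ccontr)
  define s where "s = riesz \<beta> (g * f)"
  define t where "t = riesz \<beta> (g * g)"
  assume "riesz \<beta> (g * f) \<noteq> 0"
  then have "s \<noteq> 0" by (simp add: s_def)
  \<comment> \<open>The solution of \<open>t + 2 * c * s = - 1\<close>.\<close>
  define c where "c = - (t + 1) / (2 * s)"
  let ?h = "g + Poly_Mapping.single 0 c * f"
  have "?h * ?h = g * g + Poly_Mapping.single 0 (2 * c) * (g * f) + Poly_Mapping.single 0 (c * c) * (f * f)"
  proof -
    have "Poly_Mapping.single 0 (2 * c) = Poly_Mapping.single 0 c + (Poly_Mapping.single 0 c :: bipoly)"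
      "Poly_Mapping.single 0 (c * c) = Poly_Mapping.single 0 c * (Poly_Mapping.single 0 c :: bipoly)"
      by (simp_all add: mult_single flip: single_add)
    then show ?thesis by (simp only: algebra_simps)
  qed
  then have "riesz \<beta> (?h * ?h) = t + 2 * c * s"
    by (simp add: riesz_add riesz_const_mult assms(4) s_def t_def)
  also have "\<dots> = - 1" using \<open>s \<noteq> 0\<close> by (simp add: c_def field_simps)
  finally show False
    using psd assms(2,3) polys_upto_add polys_upto_const_mult
    unfolding psd_moment_matrix_iff by (metis neg_0_le_iff_le not_one_le_zero)
qed

lemma polys_upto_mult_xy_le:
  "f \<in> polys_upto l \<Longrightarrow> a + b + l \<le> k \<Longrightarrow> xy a b * f \<in> polys_upto k"
  by (rule polys_upto_mono [OF polys_upto_xy_mult])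

lemma poly_col_diff_eq_0_iff:
  assumes "f \<in> polys_upto k" "g \<in> polys_upto k"
  shows "poly_col k (moment_matrix k \<beta>) (f - g) = 0\<^sub>v (mdim k) \<longleftrightarrow>
    poly_col k (moment_matrix k \<beta>) f = poly_col k (moment_matrix k \<beta>) g"
  by (simp add: poly_col_eq_0_iff poly_col_eq_iff polys_upto_diff assms right_diff_distrib riesz_diff)

text \<open>A monomial of degree at most \<open>2 * k\<close> is a product of two of degree at most
  \<open>k\<close>, so each moment in range is an entry of the matrix.\<close>

lemma moment_matrix_eq_iff:
  "moment_matrix k \<beta> = moment_matrix k \<gamma> \<longleftrightarrow> (\<forall>u v. u + v \<le> 2 * k \<longrightarrow> \<beta> (u, v) = \<gamma> (u, v))"
proof
  assume eq: "moment_matrix k \<beta> = moment_matrix k \<gamma>"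
  show "\<forall>u v. u + v \<le> 2 * k \<longrightarrow> \<beta> (u, v) = \<gamma> (u, v)"
  proof (intro allI impI)
    fix u v assume uv: "u + v \<le> 2 * k"
    \<comment> \<open>The first factor takes as many powers of \<open>x\<close> as the bound
      \<open>k\<close> permits and then fills up with powers of \<open>y\<close>; the cofactor again
      has degree at most \<open>k\<close>.\<close>
    define a where "a = min u k"
    define b where "b = min v (k - a)"
    have "a + b \<le> k" "(u - a) + (v - b) \<le> k" and ab: "a \<le> u" "b \<le> v"
      using uv by (auto simp: a_def b_def)
    then obtain r c where r: "r < mdim k" "monomials k ! r = (a, b)"
      and c: "c < mdim k" "monomials k ! c = (u - a, v - b)"
      by (metis monomials_index)
    show "\<beta> (u, v) = \<gamma> (u, v)"
      using arg_cong [OF eq, of "\<lambda>M. M $$ (r, c)"] r c ab by (simp add: moment_matrix_def)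
  qed
next
  assume eq: "\<forall>u v. u + v \<le> 2 * k \<longrightarrow> \<beta> (u, v) = \<gamma> (u, v)"
  show "moment_matrix k \<beta> = moment_matrix k \<gamma>"
  proof (rule eq_matI)
    fix r c assume rc: "r < dim_row (moment_matrix k \<gamma>)" "c < dim_col (moment_matrix k \<gamma>)"
    then show "moment_matrix k \<beta> $$ (r, c) = moment_matrix k \<gamma> $$ (r, c)"
      using eq nth_monomials_degree [of r k] nth_monomials_degree [of c k]
      by (simp add: moment_matrix_def plus_prod_def)
  qed simp_all
qed

text \<open>The column relation is read off in the row of \<open>x^(u-c) y^(v-e)\<close>; as
  \<open>c + e = k\<close>, this monomial has degree at most \<open>k\<close> and so does index a
  row.\<close>

lemma poly_col_shift:
  assumes "poly_col k (moment_matrix k \<beta>) (xy c e) = poly_col k (moment_matrix k \<beta>) (xy a b * f)"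
    and "c + e = k" "xy a b * f \<in> polys_upto k"
    and "c \<le> u" "e \<le> v" "u + v \<le> 2 * k"
  shows "\<beta> (u, v) = riesz \<beta> (xy (u - c + a) (v - e + b) * f)"
proof -
  have "riesz \<beta> (xy (u - c) (v - e) * xy c e) = riesz \<beta> (xy (u - c) (v - e) * (xy a b * f))"
    using assms by (subst (asm) poly_col_eq_iff) auto
  then show ?thesis
    using assms(4,5) by (simp add: xy_mult flip: mult.assoc)
qed

section \<open>Uniqueness of the candidate extension\<close>

context
  fixes k n m :: nat and p q :: bipoly
  assumes shape: "relation_shape k n m p q"
begin

lemma relation_bounds: "1 \<le> n" "n \<le> k" "1 \<le> m" "m \<le> k"
  using shape by (auto simp: relation_shape_def)

lemma relation_p: "p \<in> polys_upto (n - 1)"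
  and relation_q: "q \<in> polys_upto m"
  and relation_q_less: "(a, b) \<in> Poly_Mapping.keys q \<Longrightarrow> b < m"
  using shape by (auto simp: relation_shape_def)

lemma x_relation_in_polys_upto: "xy n 0 - p \<in> polys_upto k"
  using relation_bounds
  by (intro polys_upto_diff polys_upto_mono [OF relation_p]) auto

lemma y_relation_in_polys_upto: "xy 0 m - q \<in> polys_upto k"
  using relation_bounds
  by (intro polys_upto_diff polys_upto_mono [OF relation_q]) auto

lemma algorithm_candidate_unique:
  assumes N: "algorithm_candidate k n m p q M N" and N': "algorithm_candidate k n m p q M N'"
  shows "N = N'"
proof -
  have x_rec: "\<beta> (u, v) = riesz \<beta> (xy (u - n) v * p)"
    if rel: "\<forall>f. n + f \<le> k + 1 \<longrightarrow>
        poly_col (Suc k) (moment_matrix (Suc k) \<beta>) (xy (n + f) (k + 1 - n - f)) =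
        poly_col (Suc k) (moment_matrix (Suc k) \<beta>) (xy f (k + 1 - n - f) * p)"
      and "n \<le> u" "k + 1 \<le> u + v" "u + v \<le> 2 * (k + 1)" for \<beta> u v
  proof -
    \<comment> \<open>Makes \<open>n + f = min u (k + 1)\<close>, so the column monomial of degree
      \<open>k + 1\<close> divides \<open>x^u y^v\<close> and the relation can be shifted to this
      moment.\<close>
    define f where "f = min u (k + 1) - n"
    have f: "n + f \<le> k + 1" "n + f \<le> u" "k + 1 \<le> n + f + v"
      "u + v \<le> 2 * (k + 1)" "u \<le> k + 1 \<or> k + 1 = n + f"
      using that relation_bounds by (auto simp: f_def)
    have "\<beta> (u, v) = riesz \<beta> (xy (u - (n + f) + f) (v - (k + 1 - n - f) + (k + 1 - n - f)) * p)"
    proof (rule poly_col_shift)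
      show "xy f (k + 1 - n - f) * p \<in> polys_upto (Suc k)"
        using f relation_bounds by (intro polys_upto_mult_xy_le [OF relation_p]) auto
      show "poly_col (Suc k) (moment_matrix (Suc k) \<beta>) (xy (n + f) (k + 1 - n - f)) =
          poly_col (Suc k) (moment_matrix (Suc k) \<beta>) (xy f (k + 1 - n - f) * p)"
        using rel f(1) by blast
    qed (use f in auto)
    moreover have "u - (n + f) + f = u - n" "v - (k + 1 - n - f) + (k + 1 - n - f) = v"
      using f that by auto
    ultimately show ?thesis by simp
  qed
  have y_rec: "\<beta> (u, v) = riesz \<beta> (xy u (v - m) * q)"
    if rel: "\<forall>g. m + g \<le> k + 1 \<longrightarrow>
        poly_col (Suc k) (moment_matrix (Suc k) \<beta>) (xy (k + 1 - m - g) (m + g)) =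
        poly_col (Suc k) (moment_matrix (Suc k) \<beta>) (xy (k + 1 - m - g) g * q)"
      and "m \<le> v" "k + 1 \<le> u + v" "u + v \<le> 2 * (k + 1)" for \<beta> u v
  proof -
    \<comment> \<open>The same choice with the variables exchanged:
      \<open>m + g = min v (k + 1)\<close>.\<close>
    define g where "g = min v (k + 1) - m"
    have g: "m + g \<le> k + 1" "m + g \<le> v" "k + 1 \<le> m + g + u"
      "u + v \<le> 2 * (k + 1)" "v \<le> k + 1 \<or> k + 1 = m + g"
      using that relation_bounds by (auto simp: g_def)
    have "\<beta> (u, v) = riesz \<beta> (xy (u - (k + 1 - m - g) + (k + 1 - m - g)) (v - (m + g) + g) * q)"
    proof (rule poly_col_shift)
      show "xy (k + 1 - m - g) g * q \<in> polys_upto (Suc k)"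
        using g relation_bounds by (intro polys_upto_mult_xy_le [OF relation_q]) auto
      show "poly_col (Suc k) (moment_matrix (Suc k) \<beta>) (xy (k + 1 - m - g) (m + g)) =
          poly_col (Suc k) (moment_matrix (Suc k) \<beta>) (xy (k + 1 - m - g) g * q)"
        using rel g(1) by blast
    qed (use g in auto)
    moreover have "v - (m + g) + g = v - m" "u - (k + 1 - m - g) + (k + 1 - m - g) = u"
      using g that by auto
    ultimately show ?thesis by simp
  qed
  obtain \<beta> where \<beta>: "M = moment_matrix k \<beta>" "N = moment_matrix (Suc k) \<beta>"
    using N by (auto simp: algorithm_candidate_def moment_extension_def)
  obtain \<gamma> where \<gamma>: "M = moment_matrix k \<gamma>" "N' = moment_matrix (Suc k) \<gamma>"
    using N' by (auto simp: algorithm_candidate_def moment_extension_def)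
  have low: "\<beta> (u, v) = \<gamma> (u, v)" if "u + v \<le> 2 * k" for u v
    using \<beta>(1) \<gamma>(1) that moment_matrix_eq_iff by metis
  \<comment> \<open>Outer induction on the degree, inner induction on the \<open>y\<close>-exponent.
    The relation for \<open>X^n\<close> lowers the degree; the terms of \<open>q\<close> of full
    degree \<open>m\<close> preserve it but lower the \<open>y\<close>-exponent.\<close>
  have "s \<le> 2 * (k + 1) \<Longrightarrow> u + v = s \<Longrightarrow> \<beta> (u, v) = \<gamma> (u, v)" for s u v
  proof (induction s arbitrary: u v rule: less_induct)
    case (less s)
    note IHs = less.IH and s = less.prems(1)
    show ?case
      using less.prems(2)
    proof (induction v arbitrary: u rule: less_induct)
      case (less v)
      \<comment> \<open>Exhaustive because \<open>n\<close> and \<open>m\<close> are at most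
        \<open>k\<close>: if \<open>u < n\<close> and \<open>v < m\<close>, the degree is below
        \<open>2 * k\<close>.\<close>
      consider "u + v \<le> 2 * k" | "k + 1 \<le> u + v" "n \<le> u" | "k + 1 \<le> u + v" "m \<le> v"
        using relation_bounds by linarith
      then show ?case
      proof cases
        case 1
        then show ?thesis by (rule low)
      next
        case 2
        have "riesz \<beta> (xy (u - n) v * p) = riesz \<gamma> (xy (u - n) v * p)"
        proof (rule riesz_cong)
          fix z assume "z \<in> Poly_Mapping.keys (xy (u - n) v * p)"
          then obtain a b where z: "z = (u - n + a, v + b)" and "(a, b) \<in> Poly_Mapping.keys p"
            by (auto simp: keys_xy_mult)
          then have "a + b \<le> n - 1" using relation_p by (auto simp: polys_upto_iff)
          then show "\<beta> z = \<gamma> z"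
            unfolding z using 2 less.prems s relation_bounds
            by (intro IHs [of "u - n + a + (v + b)"]) auto
        qed
        moreover have "\<beta> (u, v) = riesz \<beta> (xy (u - n) v * p)"
          using N \<beta>(2) 2 less.prems s by (intro x_rec) (auto simp: algorithm_candidate_def)
        moreover have "\<gamma> (u, v) = riesz \<gamma> (xy (u - n) v * p)"
          using N' \<gamma>(2) 2 less.prems s by (intro x_rec) (auto simp: algorithm_candidate_def)
        ultimately show ?thesis by simp
      next
        case 3
        have "riesz \<beta> (xy u (v - m) * q) = riesz \<gamma> (xy u (v - m) * q)"
        proof (rule riesz_cong)
          fix z assume "z \<in> Poly_Mapping.keys (xy u (v - m) * q)"
          then obtain a b where z: "z = (u + a, v - m + b)" and ab: "(a, b) \<in> Poly_Mapping.keys q"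
            by (auto simp: keys_xy_mult)
          then have "a + b \<le> m" "b < m"
            using relation_q relation_q_less by (auto simp: polys_upto_iff)
          then consider "a + b = m" "b < m" | "a + b < m" by linarith
          then show "\<beta> z = \<gamma> z"
            unfolding z
          proof cases
            case 1
            then show "\<beta> (u + a, v - m + b) = \<gamma> (u + a, v - m + b)"
              using 3 less.prems by (intro less.IH) auto
          next
            case 2
            then show "\<beta> (u + a, v - m + b) = \<gamma> (u + a, v - m + b)"
              using 3 less.prems s by (intro IHs [of "u + a + (v - m + b)"]) auto
          qed
        qed
        moreover have "\<beta> (u, v) = riesz \<beta> (xy u (v - m) * q)"
          using N \<beta>(2) 3 less.prems s by (intro y_rec) (auto simp: algorithm_candidate_def)
        moreover have "\<gamma> (u, v) = riesz \<gamma> (xy u (v - m) * q)"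
          using N' \<gamma>(2) 3 less.prems s by (intro y_rec) (auto simp: algorithm_candidate_def)
        ultimately show ?thesis by simp
      qed
    qed
  qed
  then show ?thesis
    by (simp add: \<beta>(2) \<gamma>(2) moment_matrix_eq_iff)
qed

text \<open>Each relation required of a candidate is a monomial multiple, of degree at most
  \<open>k + 1\<close>, of one of the two basic relations.\<close>

lemma recursively_generated_candidate:
  assumes ext: "moment_extension k M N" and rg: "recursively_generated (Suc k) N"
    and x: "poly_col (Suc k) N (xy n 0 - p) = 0\<^sub>v (mdim (Suc k))"
    and y: "poly_col (Suc k) N (xy 0 m - q) = 0\<^sub>v (mdim (Suc k))"
  shows "algorithm_candidate k n m p q M N"
proof -
  obtain \<gamma> where N: "N = moment_matrix (Suc k) \<gamma>"
    using ext by (auto simp: moment_extension_def)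
  have mult: "poly_col (Suc k) N (g * f) = 0\<^sub>v (mdim (Suc k))"
    if "poly_col (Suc k) N f = 0\<^sub>v (mdim (Suc k))" "f \<in> polys_upto k"
      "g \<in> polys_upto (Suc k)" "g * f \<in> polys_upto (Suc k)" for f g
    using rg that polys_upto_mono [of f k "Suc k"]
    by (auto simp: recursively_generated_def mult.commute)
  have "poly_col (Suc k) N (xy (n + f) (k + 1 - n - f)) =
      poly_col (Suc k) N (xy f (k + 1 - n - f) * p)" if "n + f \<le> k + 1" for f
  proof -
    have *: "xy f (k + 1 - n - f) * p \<in> polys_upto (Suc k)"
      using that by (intro polys_upto_mult_xy_le [OF relation_p]) auto
    have eq: "xy (n + f) (k + 1 - n - f) - xy f (k + 1 - n - f) * p =
        xy f (k + 1 - n - f) * (xy n 0 - p)"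
      by (simp add: right_diff_distrib xy_mult add.commute)
    have "xy (n + f) (k + 1 - n - f) - xy f (k + 1 - n - f) * p \<in> polys_upto (Suc k)"
      using that by (intro polys_upto_diff *) auto
    then have "poly_col (Suc k) N (xy (n + f) (k + 1 - n - f) - xy f (k + 1 - n - f) * p) =
        0\<^sub>v (mdim (Suc k))"
      unfolding eq using that by (intro mult [OF x x_relation_in_polys_upto]) auto
    then show ?thesis
      unfolding N by (subst (asm) poly_col_diff_eq_0_iff) (use that * in auto)
  qed
  moreover have "poly_col (Suc k) N (xy (k + 1 - m - g) (m + g)) =
      poly_col (Suc k) N (xy (k + 1 - m - g) g * q)" if "m + g \<le> k + 1" for g
  proof -
    have *: "xy (k + 1 - m - g) g * q \<in> polys_upto (Suc k)"
      using that by (intro polys_upto_mult_xy_le [OF relation_q]) auto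
    have eq: "xy (k + 1 - m - g) (m + g) - xy (k + 1 - m - g) g * q =
        xy (k + 1 - m - g) g * (xy 0 m - q)"
      by (simp add: right_diff_distrib xy_mult add.commute)
    have "xy (k + 1 - m - g) (m + g) - xy (k + 1 - m - g) g * q \<in> polys_upto (Suc k)"
      using that by (intro polys_upto_diff *) auto
    then have "poly_col (Suc k) N (xy (k + 1 - m - g) (m + g) - xy (k + 1 - m - g) g * q) =
        0\<^sub>v (mdim (Suc k))"
      unfolding eq using that by (intro mult [OF y y_relation_in_polys_upto]) auto
    then show ?thesis
      unfolding N by (subst (asm) poly_col_diff_eq_0_iff) (use that * in auto)
  qed
  ultimately show ?thesis
    using ext by (auto simp: algorithm_candidate_def)
qed

end

section \<open>Column relations inherited by extensions\<close>

lemma psd_extension_kernel: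
  assumes "moment_extension k M N" "psd N" "f \<in> polys_upto k"
    and "poly_col k M f = 0\<^sub>v (mdim k)"
  shows "poly_col (Suc k) N f = 0\<^sub>v (mdim (Suc k))"
proof -
  obtain \<gamma> where M: "M = moment_matrix k \<gamma>" and N: "N = moment_matrix (Suc k) \<gamma>"
    using assms(1) by (auto simp: moment_extension_def)
  have f: "f \<in> polys_upto (Suc k)" using polys_upto_mono [OF assms(3)] by simp
  \<comment> \<open>This uses only moments seen by \<open>M\<close>; positivity of \<open>N\<close>
    then makes \<open>f\<close> orthogonal to all polynomials of degree at most
    \<open>k + 1\<close>.\<close>
  have "riesz \<gamma> (f * f) = 0"
    using assms(3,4) by (intro riesz_mult_eq_0 [of f k]) (auto simp: M poly_col_eq_0_iff)
  then have "riesz \<gamma> (xy a b * f) = 0" if "a + b \<le> Suc k" for a b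
    using riesz_psd_null [OF _ f] assms(2) that by (simp add: N)
  then show ?thesis
    by (simp add: N poly_col_eq_0_iff [OF f])
qed

text \<open>The relations of \<open>M\<close> pass to \<open>N\<close> for different reasons: by
  definition for an \<open>RG_extension\<close>, by \<open>psd_extension_kernel\<close> in the other
  case. Recursive generation does the rest for both.\<close>

lemma extension_is_candidate:
  assumes shape: "relation_shape k n m p q"
    and x: "poly_col k M (xy n 0 - p) = 0\<^sub>v (mdim k)"
    and y: "poly_col k M (xy 0 m - q) = 0\<^sub>v (mdim k)"
    and N: "psd_RG_moment_extension k M N \<or> RG_extension k M N"
  shows "algorithm_candidate k n m p q M N"
proof (rule recursively_generated_candidate [OF shape])
  show "moment_extension k M N" "recursively_generated (Suc k) N"
    using N by (auto simp: psd_RG_moment_extension_def RG_extension_def)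
  have "poly_col (Suc k) N f = 0\<^sub>v (mdim (Suc k))"
    if "poly_col k M f = 0\<^sub>v (mdim k)" "f \<in> polys_upto k" for f
    using N that psd_extension_kernel
    by (auto simp: psd_RG_moment_extension_def RG_extension_def)
  then show "poly_col (Suc k) N (xy n 0 - p) = 0\<^sub>v (mdim (Suc k))"
    "poly_col (Suc k) N (xy 0 m - q) = 0\<^sub>v (mdim (Suc k))"
    using x y x_relation_in_polys_upto [OF shape] y_relation_in_polys_upto [OF shape] by auto
qed

section \<open>Rank, span and orthogonal projection\<close>

context vec_space
begin

text \<open>\<open>lincomb\<close> runs over a set of vectors, so injectivity of
  \<open>col A\<close> on \<open>I\<close> is what lets each index keep its own coefficient.\<close>

lemma lincomb_cols_image:
  assumes A: "A \<in> carrier_mat n nc" and I: "I \<subseteq> {..<nc}" and inj: "inj_on (col A) I"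
    and v: "v \<in> carrier_vec nc"
    and a: "\<And>i. i \<in> I \<Longrightarrow> v $ i = a (col A i)" "\<And>i. i < nc \<Longrightarrow> i \<notin> I \<Longrightarrow> v $ i = 0"
  shows "lincomb a (col A ` I) = A *\<^sub>v v"
proof (rule eq_vecI)
  have fin: "finite I" using I by (rule finite_subset) simp
  have C: "col A ` I \<subseteq> carrier_vec n" using A I by auto
  show "dim_vec (lincomb a (col A ` I)) = dim_vec (A *\<^sub>v v)"
    using A C fin by (simp add: lincomb_dim)
  fix r assume "r < dim_vec (A *\<^sub>v v)"
  then have r: "r < n" using A by simp
  have "lincomb a (col A ` I) $ r = (\<Sum>i\<in>I. a (col A i) * col A i $ r)"
    by (simp add: lincomb_index [OF r C] sum.reindex [OF inj])
  also have "\<dots> = (\<Sum>i\<in>I. A $$ (r, i) * v $ i)"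
    using A I r a(1) by (intro sum.cong) auto
  also have "\<dots> = (\<Sum>i<nc. A $$ (r, i) * v $ i)"
    using I a(2) by (intro sum.mono_neutral_left) auto
  also have "\<dots> = (A *\<^sub>v v) $ r"
    using A v r by (simp add: scalar_prod_def atLeast0LessThan)
  finally show "lincomb a (col A ` I) $ r = (A *\<^sub>v v) $ r" .
qed

text \<open>The columns indexed by \<open>I\<close> form a basis of the column space. Phrasing this
  by coefficient vectors supported on \<open>I\<close> suits polynomials with prescribed
  monomials.\<close>

lemma rank_eq_card_basis_columns:
  assumes A: "A \<in> carrier_mat n nc" and I: "I \<subseteq> {..<nc}"
    and indep: "\<And>v. v \<in> carrier_vec nc \<Longrightarrow> (\<And>i. i < nc \<Longrightarrow> i \<notin> I \<Longrightarrow> v $ i = 0) \<Longrightarrow>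
      A *\<^sub>v v = 0\<^sub>v n \<Longrightarrow> v = 0\<^sub>v nc"
    and spans: "\<And>c. c < nc \<Longrightarrow> \<exists>v\<in>carrier_vec nc. (\<forall>i<nc. i \<notin> I \<longrightarrow> v $ i = 0) \<and> A *\<^sub>v v = col A c"
  shows "rank A = card I"
proof -
  let ?S = "col A ` I"
  have fin: "finite ?S" using finite_subset [OF I] by simp
  have C: "?S \<subseteq> carrier_vec n" using A I by auto
  have inj: "inj_on (col A) I"
  proof (rule inj_onI, rule ccontr)
    fix i j assume ij: "i \<in> I" "j \<in> I" "col A i = col A j" "i \<noteq> j"
    \<comment> \<open>Two equal columns would yield this nonzero kernel vector supported on
      \<open>I\<close>.\<close>
    define v :: "'a vec" where "v = vec nc (\<lambda>l. if l = i then 1 else if l = j then - 1 else 0)"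
    have lt: "i < nc" "j < nc" using ij I by auto
    have "A *\<^sub>v v = 0\<^sub>v n"
    proof (rule eq_vecI)
      fix r assume "r < dim_vec (0\<^sub>v n :: 'a vec)"
      then have r: "r < n" by simp
      have "(A *\<^sub>v v) $ r = (\<Sum>l<nc. (if l = i then A $$ (r, i) else 0) - (if l = j then A $$ (r, j) else 0))"
        using A r ij(4) by (auto simp: v_def scalar_prod_def atLeast0LessThan intro!: sum.cong)
      also have "\<dots> = A $$ (r, i) - A $$ (r, j)"
        using lt by (simp add: sum_subtractf)
      also have "\<dots> = 0"
        using A r lt arg_cong [OF ij(3), of "\<lambda>w. w $ r"] by simp
      finally show "(A *\<^sub>v v) $ r = 0\<^sub>v n $ r" using r by simp
    qed (use A in simp)
    then have "v = 0\<^sub>v nc"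
      using ij by (intro indep) (auto simp: v_def)
    then show False
      using lt(1) by (auto simp: v_def dest!: arg_cong [of _ _ "\<lambda>w. w $ i"])
  qed
  have li: "lin_indpt ?S"
  proof
    assume "lin_dep ?S"
    from finite_lin_dep [OF fin this] C obtain a w
      where a: "lincomb a ?S = 0\<^sub>v n" "w \<in> ?S" "a w \<noteq> 0"
      by auto
    define v where "v = vec nc (\<lambda>i. if i \<in> I then a (col A i) else 0)"
    have "lincomb a ?S = A *\<^sub>v v"
      using I by (intro lincomb_cols_image [OF A I inj]) (auto simp: v_def)
    then have "v = 0\<^sub>v nc"
      using a(1) by (intro indep) (auto simp: v_def)
    moreover obtain i where "i \<in> I" "w = col A i" using a(2) by auto
    ultimately show False
      using a(3) I by (auto simp: v_def dest!: arg_cong [of _ _ "\<lambda>w. w $ i"])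
  qed
  have cols_span: "x \<in> span ?S" if x: "x \<in> set (cols A)" for x
  proof -
    obtain c where c: "c < nc" "x = col A c"
      using x A by (auto simp: cols_def)
    obtain v where v: "v \<in> carrier_vec nc" "\<forall>i<nc. i \<notin> I \<longrightarrow> v $ i = 0" "A *\<^sub>v v = x"
      using spans [OF c(1)] c(2) by auto
    have "lincomb (\<lambda>w. v $ the_inv_into I (col A) w) ?S = A *\<^sub>v v"
      using v(2) by (intro lincomb_cols_image [OF A I inj v(1)]) (auto simp: the_inv_into_f_f inj)
    then show ?thesis
      using fin v(3) by (intro in_spanI) auto
  qed
  \<comment> \<open>The rank is the size of a maximal independent set of columns; any further column
    already lies in the span of \<open>?S\<close>.\<close>
  have "maximal ?S (\<lambda>T. T \<subseteq> set (cols A) \<and> lin_indpt T)"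
    unfolding maximal_def
  proof (intro conjI allI impI)
    show "?S \<subseteq> set (cols A)" using A I by (auto simp: cols_def)
    show "lin_indpt ?S" by (rule li)
    fix T assume T: "?S \<subseteq> T \<and> T \<subseteq> set (cols A) \<and> lin_indpt T"
    have finT: "finite T" using T by (meson List.finite_set finite_subset)
    have CT: "T \<subseteq> carrier_vec n" using T A cols_dim [of A] by auto
    show "T = ?S"
    proof (rule ccontr)
      assume "T \<noteq> ?S"
      then obtain x where x: "x \<in> T" "x \<notin> ?S" using T by auto
      then have "x \<in> span (T - {x})"
        using cols_span [of x] T span_is_monotone [of ?S "T - {x}"] by blast
      then have "lin_dep T"
        using lindep_span [of T] finT CT x(1) by auto
      then show False using T by simp
    qed
  qed
  from rank_card_indpt [OF A this] show ?thesis
    by (simp add: card_image inj)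
qed

end

section \<open>Spans, kernels and ranges of real matrices\<close>

lemma vspan_base: "S \<subseteq> carrier_vec n \<Longrightarrow> x \<in> S \<Longrightarrow> x \<in> vspan n S"
proof -
  interpret vec_space "TYPE(real)" n .
  show "S \<subseteq> carrier_vec n \<Longrightarrow> x \<in> S \<Longrightarrow> x \<in> vspan n S"
    unfolding vspan_def using in_own_span by auto
qed

lemma vspan_zero: "0\<^sub>v n \<in> vspan n S"
proof -
  interpret vec_space "TYPE(real)" n .
  show ?thesis
    unfolding vspan_def by (rule in_spanI [of _ "\<lambda>_. 0" "{}"]) (auto simp: lincomb_def)
qed

lemma vspan_add:
  "S \<subseteq> carrier_vec n \<Longrightarrow> x \<in> vspan n S \<Longrightarrow> y \<in> vspan n S \<Longrightarrow> x + y \<in> vspan n S"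
proof -
  interpret vec_space "TYPE(real)" n .
  show "S \<subseteq> carrier_vec n \<Longrightarrow> x \<in> vspan n S \<Longrightarrow> y \<in> vspan n S \<Longrightarrow> x + y \<in> vspan n S"
    unfolding vspan_def using span_add1 by simp
qed

lemma vspan_smult: "S \<subseteq> carrier_vec n \<Longrightarrow> x \<in> vspan n S \<Longrightarrow> c \<cdot>\<^sub>v x \<in> vspan n S"
proof -
  interpret vec_space "TYPE(real)" n .
  show "S \<subseteq> carrier_vec n \<Longrightarrow> x \<in> vspan n S \<Longrightarrow> c \<cdot>\<^sub>v x \<in> vspan n S"
    unfolding vspan_def by (rule smult_in_span)
qed

lemma vspan_subset_mat_kernel:
  assumes A: "A \<in> carrier_mat nr n" and S: "S \<subseteq> mat_kernel A"
  shows "vspan n S \<subseteq> mat_kernel A"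
proof -
  interpret vec_space "TYPE(real)" n .
  have "LinearCombinations.submodule class_ring (mat_kernel A) (module_vec TYPE(real) n)"
    using A by (intro LinearCombinations.submodule.intro)
      (auto simp: mat_kernel_def mult_add_distrib_mat_vec mult_mat_vec module_axioms)
  then show ?thesis
    unfolding vspan_def by (intro span_is_subset S)
qed

lemma mat_range_eq:
  "mat_range A = {y \<in> carrier_vec (dim_row A). \<exists>x\<in>carrier_vec (dim_col A). A *\<^sub>v x = y}"
proof -
  interpret vec_space "TYPE(real)" "dim_row A" .
  show ?thesis
    using col_space_eq [of A "dim_col A"] by (simp add: mat_range_def vspan_def col_space_def)
qed

text \<open>Gram-Schmidt, by induction on \<open>S\<close>, for the possibly degenerate form that
  sends \<open>f\<close> and \<open>g\<close> to \<open>riesz \<beta> (f * g)\<close>.\<close>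

lemma orthogonal_projection:
  assumes psd: "psd (moment_matrix k \<beta>)" and "finite S" "S \<subseteq> {(i, j). i + j \<le> k}"
    and "g \<in> polys_upto k"
  shows "\<exists>f. Poly_Mapping.keys f \<subseteq> S \<and> (\<forall>(a, b)\<in>S. riesz \<beta> (xy a b * (g - f)) = 0)"
  using assms(2-)
proof (induction S arbitrary: g rule: finite_induct)
  case empty
  show ?case by (rule exI [of _ 0]) simp
next
  case (insert z S)
  obtain a b where z: "z = (a, b)" by fastforce
  have ab: "xy a b \<in> polys_upto k" using insert.prems z by simp
  obtain f where f: "Poly_Mapping.keys f \<subseteq> S" "\<forall>(a, b)\<in>S. riesz \<beta> (xy a b * (g - f)) = 0"
    using insert.IH [of g] insert.prems by auto
  obtain e where e: "Poly_Mapping.keys e \<subseteq> S" "\<forall>(c, e')\<in>S. riesz \<beta> (xy c e' * (xy a b - e)) = 0"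
    using insert.IH [OF _ ab] insert.prems by auto
  have upto: "h \<in> polys_upto k" if "Poly_Mapping.keys h \<subseteq> S" for h
    using that insert.prems(1) by (auto simp: polys_upto_iff)
  \<comment> \<open>The part of the new monomial that is orthogonal to \<open>S\<close>.\<close>
  define s where "s = xy a b - e"
  have s: "s \<in> polys_upto k" unfolding s_def by (rule polys_upto_diff [OF ab upto [OF e(1)]])
  \<comment> \<open>If \<open>s\<close> is a null vector, division by zero gives
    \<open>c = 0\<close>. This is still right, since by \<open>riesz_psd_null\<close> the numerator
    vanishes too.\<close>
  define c where "c = riesz \<beta> (s * (g - f)) / riesz \<beta> (s * s)"
  define h where "h = f + Poly_Mapping.single 0 c * s"
  have "c * riesz \<beta> (s * s) = riesz \<beta> (s * (g - f))"
  proof (cases "riesz \<beta> (s * s) = 0")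
    case True
    have "riesz \<beta> ((g - f) * s) = 0"
      by (rule riesz_psd_null [OF psd s polys_upto_diff [OF insert.prems(2) upto [OF f(1)]] True])
    then show ?thesis by (simp only: True mult.commute mult_zero_left)
  qed (simp add: c_def)
  have split: "riesz \<beta> (u * (g - h)) = riesz \<beta> (u * (g - f)) - c * riesz \<beta> (u * s)" for u
  proof -
    have "u * (g - h) = u * (g - f) - Poly_Mapping.single 0 c * (u * s)"
      by (simp add: h_def algebra_simps)
    then show ?thesis by (simp only: riesz_diff riesz_const_mult)
  qed
  have S: "riesz \<beta> (xy u v * (g - h)) = 0" if "(u, v) \<in> S" for u v
    using bspec [OF f(2) that] bspec [OF e(2) that] by (simp add: split s_def)
  \<comment> \<open>\<open>e\<close> is supported on \<open>S\<close>, so orthogonality to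
    \<open>s\<close> and to \<open>e\<close> gives orthogonality to the new monomial
    \<open>s + e\<close>.\<close>
  have "riesz \<beta> (e * (g - h)) = 0"
  proof (rule riesz_mult_eq_0_keys)
    fix w assume "w \<in> Poly_Mapping.keys e"
    then show "riesz \<beta> (xy (fst w) (snd w) * (g - h)) = 0"
      using e(1) by (intro S) auto
  qed
  moreover have "riesz \<beta> (s * (g - h)) = 0"
    using \<open>c * riesz \<beta> (s * s) = _\<close> by (simp add: split)
  moreover have "xy a b * (g - h) = s * (g - h) + e * (g - h)"
    by (simp add: s_def flip: distrib_right)
  ultimately have "riesz \<beta> (xy a b * (g - h)) = 0"
    by (simp only: riesz_add)
  moreover have "Poly_Mapping.keys h \<subseteq> insert z S"
  proof
    fix w assume "w \<in> Poly_Mapping.keys h"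
    then have "w \<in> Poly_Mapping.keys f \<or> w \<in> Poly_Mapping.keys s"
      by (auto simp: h_def in_keys_iff lookup_add)
    then show "w \<in> insert z S"
      using f(1) e(1) keys_diff [of "xy a b" e] by (auto simp: s_def z)
  qed
  ultimately show ?case
    using S z by (intro exI [of _ h]) auto
qed

text \<open>A combination of the new columns is the upper part of some \<open>w(X,Y)\<close> with
  \<open>w\<close> supported in degree \<open>k + 1\<close>. The projection of \<open>w\<close> to
  degree at most \<open>k\<close> has the same pairings with all rows of the smaller matrix.\<close>

lemma mat_range_block_B:
  assumes psd: "psd (moment_matrix (Suc k) \<beta>)"
  shows "mat_range (block_B k (moment_matrix (Suc k) \<beta>)) \<subseteq> mat_range (moment_matrix k \<beta>)"
proof
  let ?B = "block_B k (moment_matrix (Suc k) \<beta>)" and ?N = "moment_matrix (Suc k) \<beta>"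
  let ?l = "mdim (Suc k) - mdim k"
  fix y assume "y \<in> mat_range ?B"
  then obtain x where x: "x \<in> carrier_vec ?l" and y: "y = ?B *\<^sub>v x"
    by (auto simp: mat_range_eq block_B_def)
  define z where "z = 0\<^sub>v (mdim k) @\<^sub>v x"
  have z: "z \<in> carrier_vec (mdim (Suc k))"
    using append_carrier_vec [OF zero_carrier_vec x, of "mdim k"] mdim_le_Suc [of k]
    by (simp add: z_def)
  define w where "w = poly_of_vec (Suc k) z"
  have w: "w \<in> polys_upto (Suc k)" by (simp add: w_def poly_of_vec_in_polys_upto)
  have coeff_w: "coeff_vec (Suc k) w = z" by (simp add: w_def coeff_vec_poly_of_vec z)
  have "finite {(i, j). i + j \<le> k}" "{(i, j). i + j \<le> k} \<subseteq> {(i, j). i + j \<le> Suc k}"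
    using finite_degree_le by auto
  from orthogonal_projection [OF psd this w]
  obtain f where f: "Poly_Mapping.keys f \<subseteq> {(i, j). i + j \<le> k}"
    and orth: "\<forall>(a, b)\<in>{(i, j). i + j \<le> k}. riesz \<beta> (xy a b * (w - f)) = 0"
    by blast
  have fk: "f \<in> polys_upto k" using f by (auto simp: polys_upto_iff)
  have "moment_matrix k \<beta> *\<^sub>v coeff_vec k f = y"
  proof (rule eq_vecI)
    fix r assume "r < dim_vec y"
    then have r: "r < mdim k" by (simp add: y block_B_def)
    obtain a b where ab: "monomials k ! r = (a, b)" by fastforce
    have ab': "a + b \<le> k" using nth_monomials_degree [OF r] ab by simp
    have rS: "r < mdim (Suc k)" "monomials (Suc k) ! r = (a, b)"
      using r mdim_le_Suc [of k] ab by (auto simp: nth_monomials_Suc)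
    have "y $ r = (\<Sum>c<?l. ?N $$ (r, mdim k + c) * x $ c)"
      using r x by (simp add: y block_B_def scalar_prod_def atLeast0LessThan)
    also have "\<dots> = (\<Sum>c\<in>{mdim k..<mdim (Suc k)}. ?N $$ (r, c) * z $ c)"
      using x mdim_le_Suc [of k]
      by (intro sum.reindex_bij_witness [of _ "\<lambda>c. c - mdim k" "\<lambda>c. mdim k + c"])
        (auto simp: z_def)
    also have "\<dots> = (\<Sum>c<mdim (Suc k). ?N $$ (r, c) * z $ c)"
      using x mdim_le_Suc [of k]
      by (intro sum.mono_neutral_left) (auto simp: z_def)
    also have "\<dots> = poly_col (Suc k) ?N w $ r"
      using z rS by (simp add: poly_col_def coeff_w scalar_prod_def atLeast0LessThan)
    also have "\<dots> = riesz \<beta> (xy a b * w)"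
      by (rule poly_col_nth [OF w rS])
    also have "\<dots> = riesz \<beta> (xy a b * f)"
      using orth ab' by (auto simp: right_diff_distrib riesz_diff)
    also have "\<dots> = (moment_matrix k \<beta> *\<^sub>v coeff_vec k f) $ r"
      using poly_col_nth [OF fk r ab, of \<beta>] by (simp add: poly_col_def)
    finally show "(moment_matrix k \<beta> *\<^sub>v coeff_vec k f) $ r = y $ r" by simp
  qed (simp add: y block_B_def)
  moreover have "y \<in> carrier_vec (mdim k)" by (intro carrier_vecI) (simp add: y block_B_def)
  ultimately show "y \<in> mat_range (moment_matrix k \<beta>)"
    by (auto simp: mat_range_eq)
qed

section \<open>Moments of a square grid\<close>

text \<open>Point evaluation as the Riesz functional of a point mass, so that linearity is
  inherited.\<close>

definition peval :: "real \<Rightarrow> real \<Rightarrow> bipoly \<Rightarrow> real" where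
  "peval s t = riesz (\<lambda>(i, j). s ^ i * t ^ j)"

lemma peval_add: "peval s t (f + g) = peval s t f + peval s t g"
  and peval_diff: "peval s t (f - g) = peval s t f - peval s t g"
  and peval_sum: "peval s t (\<Sum>i\<in>I. F i) = (\<Sum>i\<in>I. peval s t (F i))"
  and peval_xy [simp]: "peval s t (xy a b) = s ^ a * t ^ b"
  and peval_single [simp]: "peval s t (Poly_Mapping.single (a, b) c) = c * (s ^ a * t ^ b)"
  and peval_zero [simp]: "peval s t 0 = 0"
  by (simp_all add: peval_def riesz_add riesz_diff riesz_sum)

lemma peval_mult: "peval s t (f * g) = peval s t f * peval s t g"
proof (induction f rule: bipoly_induct)
  case (single k c)
  show ?case
  proof (induction g rule: bipoly_induct)
    case (single l e)
    then show ?case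
      by (cases k; cases l) (simp add: mult_single power_add)
  qed (simp_all add: distrib_left peval_add)
qed (simp_all add: distrib_right peval_add)

definition grid_moments :: "nat \<Rightarrow> nat \<times> nat \<Rightarrow> real" where
  "grid_moments d = (\<lambda>(i, j). \<Sum>s<d. \<Sum>t<d. real s ^ i * real t ^ j)"

lemma riesz_grid_moments: "riesz (grid_moments d) f = (\<Sum>s<d. \<Sum>t<d. peval (real s) (real t) f)"
proof (induction f rule: bipoly_induct)
  case (single k c)
  then show ?case
    by (cases k) (simp add: grid_moments_def sum_distrib_left)
qed (simp_all add: riesz_add peval_add sum.distrib)

lemma riesz_grid_square_eq_0_iff:
  "riesz (grid_moments d) (f * f) = 0 \<longleftrightarrow> (\<forall>s<d. \<forall>t<d. peval (real s) (real t) f = 0)"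
  by (subst riesz_grid_moments, subst sum_nonneg_eq_0_iff)
     (auto simp: peval_mult sum_nonneg sum_nonneg_eq_0_iff)

text \<open>A column relation makes \<open>riesz (grid_moments d) (f * f)\<close> zero, which is a
  sum of squares of grid values. The criterion does not depend on \<open>k\<close>, so relations can
  be moved between matrices of different size.\<close>

lemma grid_poly_col_eq_0_iff:
  assumes "f \<in> polys_upto k"
  shows "poly_col k (moment_matrix k (grid_moments d)) f = 0\<^sub>v (mdim k) \<longleftrightarrow>
    (\<forall>s<d. \<forall>t<d. peval (real s) (real t) f = 0)"
proof
  assume "poly_col k (moment_matrix k (grid_moments d)) f = 0\<^sub>v (mdim k)"
  then have "riesz (grid_moments d) (f * f) = 0"
    using assms by (intro riesz_mult_eq_0 [OF assms]) (auto simp: poly_col_eq_0_iff)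
  then show "\<forall>s<d. \<forall>t<d. peval (real s) (real t) f = 0"
    by (simp add: riesz_grid_square_eq_0_iff)
next
  assume "\<forall>s<d. \<forall>t<d. peval (real s) (real t) f = 0"
  then show "poly_col k (moment_matrix k (grid_moments d)) f = 0\<^sub>v (mdim k)"
    by (simp add: poly_col_eq_0_iff assms riesz_grid_moments peval_mult)
qed

lemma grid_psd: "psd (moment_matrix k (grid_moments d))"
  by (simp add: psd_moment_matrix_iff riesz_grid_moments peval_mult sum_nonneg)

text \<open>Polynomials vanishing on the grid form an ideal.\<close>

lemma grid_recursively_generated: "recursively_generated k (moment_matrix k (grid_moments d))"
  by (auto simp: recursively_generated_def grid_poly_col_eq_0_iff peval_mult)

section \<open>Polynomials determined by their values on the grid\<close>

lemma vanishing_power_sum: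
  assumes zero: "\<And>s. s < d \<Longrightarrow> (\<Sum>i<d. c i * real s ^ i) = 0" and "i < d"
  shows "c i = 0"
proof (rule ccontr)
  assume "c i \<noteq> 0"
  \<comment> \<open>A nonzero polynomial of degree at most \<open>d - 1\<close> has at most
    \<open>d - 1\<close> roots, but all \<open>d\<close> points are roots.\<close>
  let ?Z = "{z. (\<Sum>i<d. c i * z ^ i) = 0}"
  have le: "i \<le> d - 1" and eq: "{..d - 1} = {..<d}" using assms(2) by auto
  have "finite ?Z" "card ?Z \<le> d - 1"
    using polyfun_rootbound [of c i "d - 1", unfolded eq] \<open>c i \<noteq> 0\<close> le by auto
  moreover have "real ` {..<d} \<subseteq> ?Z"
    using zero by auto
  ultimately have "card (real ` {..<d}) \<le> d - 1"
    by (meson card_mono le_trans)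
  then show False using assms(2) by (simp add: card_image)
qed

text \<open>The monic polynomial with roots \<open>0, ..., d - 1\<close> has degree
  \<open>d\<close>; its negated lower coefficients give \<open>c\<close>.\<close>

lemma power_on_grid:
  obtains c where "\<And>s. s < d \<Longrightarrow> real s ^ d = (\<Sum>i<d. c i * real s ^ i)"
proof
  define P where "P = (\<Prod>i<d. [:- real i, 1:])"
  have "degree P = d"
    by (simp add: P_def degree_prod_eq_sum_degree)
  moreover have "lead_coeff P = 1"
    by (simp add: P_def lead_coeff_prod)
  ultimately have "poly P x = (\<Sum>i<d. coeff P i * x ^ i) + x ^ d" for x
    by (simp add: poly_altdef flip: lessThan_Suc_atMost)
  moreover have "poly P (real s) = 0" if "s < d" for s
    using that by (auto simp: P_def poly_prod)
  ultimately show "real s ^ d = (\<Sum>i<d. - coeff P i * real s ^ i)" if "s < d" for s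
    using that by (simp add: sum_negf eq_neg_iff_add_eq_0 add.commute)
qed

text \<open>The exponents of monomials divisible by neither \<open>x^d\<close> nor
  \<open>y^d\<close>, the ones allowed in a remainder.\<close>

definition box :: "nat \<Rightarrow> (nat \<times> nat) set" where
  "box d = {..<d} \<times> {..<d}"

lemma box_vanishing_eq_0:
  assumes keys: "Poly_Mapping.keys f \<subseteq> box d"
    and zero: "\<And>s t. s < d \<Longrightarrow> t < d \<Longrightarrow> peval (real s) (real t) f = 0"
  shows "f = 0"
proof (rule poly_mapping_eqI)
  fix k :: "nat \<times> nat"
  obtain u v where k: "k = (u, v)" by fastforce
  have eval: "peval x y f = (\<Sum>v<d. (\<Sum>u<d. Poly_Mapping.lookup f (u, v) * x ^ u) * y ^ v)" for x y
  proof -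
    have "peval x y f = (\<Sum>(u, v)\<in>{..<d} \<times> {..<d}. Poly_Mapping.lookup f (u, v) * (x ^ u * y ^ v))"
      using keys unfolding peval_def box_def by (subst riesz_superset) (auto intro!: sum.cong)
    also have "\<dots> = (\<Sum>u<d. \<Sum>v<d. Poly_Mapping.lookup f (u, v) * (x ^ u * y ^ v))"
      by (rule sum.cartesian_product [symmetric])
    also have "\<dots> = (\<Sum>v<d. \<Sum>u<d. Poly_Mapping.lookup f (u, v) * (x ^ u * y ^ v))"
      by (rule sum.swap)
    finally show ?thesis by (simp add: sum_distrib_right mult.assoc)
  qed
  have "Poly_Mapping.lookup f (u, v) = 0" if "u < d" "v < d"
  \<comment> \<open>The one-variable statement is applied twice: for fixed \<open>s\<close> to the
    polynomial in \<open>y\<close>, then to each of its coefficients as a polynomial in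
    \<open>x\<close>.\<close>
  proof (rule vanishing_power_sum [of d "\<lambda>u. Poly_Mapping.lookup f (u, v)"])
    fix s assume "s < d"
    show "(\<Sum>u<d. Poly_Mapping.lookup f (u, v) * real s ^ u) = 0"
      by (rule vanishing_power_sum [of d "\<lambda>v. \<Sum>u<d. Poly_Mapping.lookup f (u, v) * real s ^ u"])
        (use zero \<open>s < d\<close> that in \<open>simp_all flip: eval\<close>)
  qed (rule that)
  then show "Poly_Mapping.lookup f k = Poly_Mapping.lookup 0 k"
    using keys by (cases "u < d \<and> v < d") (auto simp: k box_def in_keys_iff)
qed

section \<open>The two grid relations, the kernel they generate and the rank\<close>

context
  fixes d :: nat and c :: "nat \<Rightarrow> real"
  assumes d: "1 \<le> d" and c: "\<And>s. s < d \<Longrightarrow> real s ^ d = (\<Sum>i<d. c i * real s ^ i)"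
begin

definition x_lower :: bipoly where "x_lower = (\<Sum>i<d. Poly_Mapping.single (i, 0) (c i))"
definition y_lower :: bipoly where "y_lower = (\<Sum>i<d. Poly_Mapping.single (0, i) (c i))"

text \<open>The spanning set from \<open>G_generated\<close> in the case
  \<open>n = m = d\<close>.\<close>

definition relation_multiples :: "nat \<Rightarrow> real vec set" where
  "relation_multiples k =
     {coeff_vec k (xy i j * (xy d 0 - x_lower)) | i j. i + j + d \<le> k} \<union>
     {coeff_vec k (xy i j * (xy 0 d - y_lower)) | i j. i + j + d \<le> k}"

lemma keys_y_lower: "Poly_Mapping.keys y_lower \<subseteq> {0} \<times> {..<d}"
proof -
  have "Poly_Mapping.keys y_lower \<subseteq> (\<Union>i\<in>{..<d}. Poly_Mapping.keys (Poly_Mapping.single (0::nat, i) (c i)))"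
    unfolding y_lower_def by (rule keys_sum)
  also have "\<dots> \<subseteq> {0} \<times> {..<d}" by (auto split: if_splits)
  finally show ?thesis .
qed

lemma x_lower_in_polys_upto: "x_lower \<in> polys_upto (d - 1)"
  and y_lower_in_polys_upto: "y_lower \<in> polys_upto (d - 1)"
  unfolding x_lower_def y_lower_def by (rule polys_upto_sum, force simp: polys_upto_iff split: if_splits)+

lemma grid_relation_shape: "d \<le> k \<Longrightarrow> relation_shape k d d x_lower y_lower"
  using d keys_y_lower x_lower_in_polys_upto polys_upto_mono [OF y_lower_in_polys_upto, of d]
  by (auto simp: relation_shape_def)

lemma peval_x_relation: "s < d \<Longrightarrow> peval (real s) t (xy d 0 - x_lower) = 0"
  and peval_y_relation: "t < d \<Longrightarrow> peval s (real t) (xy 0 d - y_lower) = 0"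
  by (simp_all add: peval_diff x_lower_def y_lower_def peval_sum c)

lemma relation_multiples_carrier: "relation_multiples k \<subseteq> carrier_vec (mdim k)"
  by (auto simp: relation_multiples_def)

lemma relation_multiples_kernel:
  "relation_multiples k \<subseteq> mat_kernel (moment_matrix k (grid_moments d))"
proof
  fix v assume "v \<in> relation_multiples k"
  then consider i j where "i + j + d \<le> k" "v = coeff_vec k (xy i j * (xy d 0 - x_lower))"
    | i j where "i + j + d \<le> k" "v = coeff_vec k (xy i j * (xy 0 d - y_lower))"
    by (auto simp: relation_multiples_def)
  then obtain g where "v = coeff_vec k g" "g \<in> polys_upto k"
    and "\<forall>s<d. \<forall>t<d. peval (real s) (real t) g = 0"
  proof cases
    case 1
    have "xy d 0 - x_lower \<in> polys_upto d"
      by (intro polys_upto_diff polys_upto_mono [OF x_lower_in_polys_upto]) auto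
    then show ?thesis
      using 1 by (intro that [of "xy i j * (xy d 0 - x_lower)"])
        (auto simp: peval_mult peval_x_relation intro: polys_upto_mult_xy_le)
  next
    case 2
    have "xy 0 d - y_lower \<in> polys_upto d"
      by (intro polys_upto_diff polys_upto_mono [OF y_lower_in_polys_upto]) auto
    then show ?thesis
      using 2 by (intro that [of "xy i j * (xy 0 d - y_lower)"])
        (auto simp: peval_mult peval_y_relation intro: polys_upto_mult_xy_le)
  qed
  then show "v \<in> mat_kernel (moment_matrix k (grid_moments d))"
    using grid_poly_col_eq_0_iff [of g k d]
    by (auto simp: poly_col_def intro: mat_kernelI [OF moment_matrix_carrier])
qed

text \<open>Division with remainder by \<open>x\<^sup>d - x_lower\<close> and \<open>y\<^sup>d - y_lower\<close>; no step raises the degree, so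
  that only relations of degree at most \<open>k\<close> are used.\<close>
lemma box_reduction:
  assumes "f \<in> polys_upto k"
  shows "\<exists>r\<in>polys_upto k. Poly_Mapping.keys r \<subseteq> box d \<and>
    coeff_vec k (f - r) \<in> vspan (mdim k) (relation_multiples k)"
proof -
  let ?W = "vspan (mdim k) (relation_multiples k)"
  \<comment> \<open>Being reducible to a remainder is closed under linear combinations, so it
    suffices to treat monomials.\<close>
  define red where "red g \<longleftrightarrow> (\<exists>r\<in>polys_upto k. Poly_Mapping.keys r \<subseteq> box d \<and>
    coeff_vec k (g - r) \<in> ?W)" for g
  note W = relation_multiples_carrier [of k]
  have add: "red (f + g)" if f: "red f" and g: "red g" for f g
  proof -
    obtain r r' where r: "r \<in> polys_upto k" "Poly_Mapping.keys r \<subseteq> box d" "coeff_vec k (f - r) \<in> ?W"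
      "r' \<in> polys_upto k" "Poly_Mapping.keys r' \<subseteq> box d" "coeff_vec k (g - r') \<in> ?W"
      using f g unfolding red_def by blast
    have "(f + g) - (r + r') = (f - r) + (g - r')" by simp
    then have "coeff_vec k ((f + g) - (r + r')) \<in> ?W"
      using vspan_add [OF W r(3,6)] by (simp only: coeff_vec_add)
    then show ?thesis
      unfolding red_def using r keys_add [of r r'] by (intro bexI [of _ "r + r'"]) (auto intro: polys_upto_add)
  qed
  have mult: "red (Poly_Mapping.single 0 e * f)" if f: "red f" for e f
  proof -
    obtain r where r: "r \<in> polys_upto k" "Poly_Mapping.keys r \<subseteq> box d" "coeff_vec k (f - r) \<in> ?W"
      using f unfolding red_def by blast
    have "coeff_vec k (Poly_Mapping.single 0 e * f - Poly_Mapping.single 0 e * r) \<in> ?W"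
      using vspan_smult [OF W r(3), of e]
      by (simp only: coeff_vec_const_mult flip: right_diff_distrib)
    moreover have "Poly_Mapping.keys (Poly_Mapping.single 0 e * r) \<subseteq> box d"
      using r(2) by (auto simp: in_keys_iff subset_iff)
    ultimately show ?thesis
      unfolding red_def using r(1) by (blast intro: polys_upto_const_mult)
  qed
  have zero: "red 0"
    unfolding red_def
    by (rule bexI [of _ 0]) (auto simp: vspan_zero)
  have sum: "red (\<Sum>i\<in>I. F i)" if "\<And>i. i \<in> I \<Longrightarrow> red (F i)" for F and I :: "(nat \<times> nat) set"
    using that by (induction I rule: infinite_finite_induct) (auto intro: add zero)
  have relation: "red (xy a b * g)"
    if "coeff_vec k (xy a b * (g - h)) \<in> ?W" "red (xy a b * h)" for a b g h
  proof -
    have "red (xy a b * (g - h))"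
      unfolding red_def using that(1) by (intro bexI [of _ 0]) auto
    from add [OF this that(2)] show ?thesis by (simp add: algebra_simps)
  qed
  \<comment> \<open>Only the bound \<open>N\<close> varies in the induction, the span stays at level
    \<open>k\<close>. Trading \<open>x^d\<close> or \<open>y^d\<close> for its lower part brings a
    monomial \<open>x^u y^v\<close> down to degree at most \<open>u + v - 1\<close>.\<close>
  have "f \<in> polys_upto N \<Longrightarrow> N \<le> k \<Longrightarrow> red f" for N f
  proof (induction N arbitrary: f rule: less_induct)
    case (less N)
    have mono: "red (xy u v)" if uv: "u + v \<le> N" for u v
    proof -
      consider "u < d" "v < d" | "d \<le> u" | "d \<le> v" by linarith
      then show ?thesis
      proof cases
        case 1
        then show ?thesis
          unfolding red_def using uv less.prems(2) by (intro bexI [of _ "xy u v"]) (auto simp: box_def vspan_zero)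
      next
        case 2
        have "red (xy (u - d) v * xy d 0)"
        proof (rule relation)
          show "coeff_vec k (xy (u - d) v * (xy d 0 - x_lower)) \<in> ?W"
            using 2 uv less.prems(2)
            by (intro vspan_base [OF W]) (force simp: relation_multiples_def)
          show "red (xy (u - d) v * x_lower)"
            using 2 d uv less.prems(2)
            by (intro less.IH [of "u + v - 1"] polys_upto_mult_xy_le [OF x_lower_in_polys_upto]) auto
        qed
        then show ?thesis using 2 by (simp add: xy_mult)
      next
        case 3
        have "red (xy u (v - d) * xy 0 d)"
        proof (rule relation)
          show "coeff_vec k (xy u (v - d) * (xy 0 d - y_lower)) \<in> ?W"
            using 3 uv less.prems(2)
            by (intro vspan_base [OF W]) (force simp: relation_multiples_def)
          show "red (xy u (v - d) * y_lower)"
            using 3 d uv less.prems(2)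
            by (intro less.IH [of "u + v - 1"] polys_upto_mult_xy_le [OF y_lower_in_polys_upto]) auto
        qed
        then show ?thesis using 3 by (simp add: xy_mult)
      qed
    qed
    have "red (\<Sum>z\<in>Poly_Mapping.keys f.
        Poly_Mapping.single 0 (Poly_Mapping.lookup f z) * xy (fst z) (snd z))"
      using less.prems(1) by (intro sum mult mono) (auto simp: polys_upto_iff)
    moreover have "(\<Sum>z\<in>Poly_Mapping.keys f.
        Poly_Mapping.single 0 (Poly_Mapping.lookup f z) * xy (fst z) (snd z)) = f"
      by (subst (3) bipoly_expand [of f]) (simp add: xy_def mult_single)
    ultimately show ?case by simp
  qed
  from this [OF assms order_refl] show ?thesis by (simp only: red_def)
qed

lemma span_vanishes:
  assumes "coeff_vec k f \<in> vspan (mdim k) (relation_multiples k)" "f \<in> polys_upto k"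
  shows "poly_col k (moment_matrix k (grid_moments d)) f = 0\<^sub>v (mdim k)"
  using vspan_subset_mat_kernel [OF moment_matrix_carrier relation_multiples_kernel] assms
  by (auto simp: poly_col_def dest: mat_kernelD [OF moment_matrix_carrier])

text \<open>The remainder of a kernel polynomial vanishes on the grid as well, and being supported
  in the box it is zero.\<close>

lemma grid_kernel:
  "mat_kernel (moment_matrix k (grid_moments d)) = vspan (mdim k) (relation_multiples k)"
proof
  show "vspan (mdim k) (relation_multiples k) \<subseteq> mat_kernel (moment_matrix k (grid_moments d))"
    by (rule vspan_subset_mat_kernel [OF moment_matrix_carrier relation_multiples_kernel])
  show "mat_kernel (moment_matrix k (grid_moments d)) \<subseteq> vspan (mdim k) (relation_multiples k)"
  proof
    fix v assume v: "v \<in> mat_kernel (moment_matrix k (grid_moments d))"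
    define f where "f = poly_of_vec k v"
    have f: "f \<in> polys_upto k" by (simp add: f_def poly_of_vec_in_polys_upto)
    have coeff: "coeff_vec k f = v"
      using mat_kernelD(1) [OF moment_matrix_carrier v] by (simp add: f_def coeff_vec_poly_of_vec)
    obtain r where r: "r \<in> polys_upto k" "Poly_Mapping.keys r \<subseteq> box d"
      "coeff_vec k (f - r) \<in> vspan (mdim k) (relation_multiples k)"
      using box_reduction [OF f] by blast
    have "poly_col k (moment_matrix k (grid_moments d)) f = 0\<^sub>v (mdim k)"
      using mat_kernelD(2) [OF moment_matrix_carrier v] by (simp add: poly_col_def coeff)
    then have "peval (real s) (real t) r = 0" if "s < d" "t < d" for s t
      using that span_vanishes [OF r(3)] polys_upto_diff [OF f r(1)]
      by (auto simp: grid_poly_col_eq_0_iff f peval_diff)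
    then have "r = 0" by (rule box_vanishing_eq_0 [OF r(2)])
    then show "v \<in> vspan (mdim k) (relation_multiples k)" using r(3) coeff by simp
  qed
qed

lemma grid_G_generated:
  "d \<le> k \<Longrightarrow> G_generated k d d x_lower y_lower (moment_matrix k (grid_moments d))"
  using grid_kernel by (simp add: G_generated_def grid_psd grid_relation_shape relation_multiples_def)

text \<open>The box monomials of degree at most \<open>k\<close> index a basis of the column space:
  independent by \<open>box_vanishing_eq_0\<close>, spanning by
  \<open>box_reduction\<close>.\<close>

lemma grid_rank:
  "mat_rank (moment_matrix k (grid_moments d)) = card {(i, j). i < d \<and> j < d \<and> i + j \<le> k}"
proof -
  interpret vec_space "TYPE(real)" "mdim k" .
  let ?M = "moment_matrix k (grid_moments d)"
  let ?I = "{r. r < mdim k \<and> monomials k ! r \<in> box d}"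
  have "rank ?M = card ?I"
  proof (rule rank_eq_card_basis_columns)
    fix v assume v: "v \<in> carrier_vec (mdim k)"
      and supp: "\<And>i. i < mdim k \<Longrightarrow> i \<notin> ?I \<Longrightarrow> v $ i = 0" and 0: "?M *\<^sub>v v = 0\<^sub>v (mdim k)"
    define f where "f = poly_of_vec k v"
    have f: "f \<in> polys_upto k" by (simp add: f_def poly_of_vec_in_polys_upto)
    have coeff: "coeff_vec k f = v" using v by (simp add: f_def coeff_vec_poly_of_vec)
    have "Poly_Mapping.keys f \<subseteq> box d"
    proof
      fix z assume z: "z \<in> Poly_Mapping.keys f"
      then have "fst z + snd z \<le> k" using f by (auto simp: polys_upto_def)
      then obtain r where r: "r < mdim k" "monomials k ! r = z"
        by (metis monomials_index prod.collapse)
      then have "v $ r \<noteq> 0"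
        using z lookup_poly_of_vec [OF r(1), of v] by (simp add: f_def in_keys_iff)
      then show "z \<in> box d" using supp [OF r(1)] r by auto
    qed
    moreover have "\<forall>s<d. \<forall>t<d. peval (real s) (real t) f = 0"
      using 0 by (simp add: poly_col_def coeff flip: grid_poly_col_eq_0_iff [OF f])
    ultimately have "f = 0" by (auto intro: box_vanishing_eq_0)
    then show "v = 0\<^sub>v (mdim k)" using coeff by simp
  next
    fix c assume c: "c < mdim k"
    obtain a b where ab: "monomials k ! c = (a, b)" by fastforce
    have f: "xy a b \<in> polys_upto k" using nth_monomials_degree [OF c] ab by simp
    have unit: "coeff_vec k (xy a b) = unit_vec (mdim k) c"
      using c ab nth_monomials_eq_iff [OF _ c]
      by (intro eq_vecI) (auto simp: coeff_vec_def lookup_xy)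
    obtain r where r: "r \<in> polys_upto k" "Poly_Mapping.keys r \<subseteq> box d"
      "coeff_vec k (xy a b - r) \<in> vspan (mdim k) (relation_multiples k)"
      using box_reduction [OF f] by blast
    have "poly_col k ?M (xy a b) = poly_col k ?M r"
      using span_vanishes [OF r(3)] polys_upto_diff [OF f r(1)]
      by (simp add: poly_col_diff_eq_0_iff [OF f r(1)])
    moreover have col_unit: "?M *\<^sub>v unit_vec (mdim k) c = col ?M c"
      using c by (intro eq_vecI) (auto simp: scalar_prod_right_unit)
    ultimately have "?M *\<^sub>v coeff_vec k r = col ?M c"
      using c by (simp add: poly_col_def unit col_unit)
    moreover have "coeff_vec k r $ i = 0" if "i < mdim k" "i \<notin> ?I" for i
    proof -
      have "monomials k ! i \<notin> Poly_Mapping.keys r" using that r(2) by auto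
      then show ?thesis using that(1) by (simp add: coeff_vec_def in_keys_iff)
    qed
    ultimately show "\<exists>v\<in>carrier_vec (mdim k). (\<forall>i<mdim k. i \<notin> ?I \<longrightarrow> v $ i = 0) \<and> ?M *\<^sub>v v = col ?M c"
      by (intro bexI [of _ "coeff_vec k r"]) auto
  qed auto
  also have "card ?I = card {(i, j). i < d \<and> j < d \<and> i + j \<le> k}"
  proof (rule bij_betw_same_card [of "(!) (monomials k)"])
    have "bij_betw ((!) (monomials k)) ?I ((!) (monomials k) ` ?I)"
      by (rule bij_betw_subset [OF bij_betw_monomials]) auto
    moreover have "(!) (monomials k) ` ?I = {(i, j). i < d \<and> j < d \<and> i + j \<le> k}"
    proof (intro equalityI subsetI)
      fix z assume "z \<in> {(i, j). i < d \<and> j < d \<and> i + j \<le> k}"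
      then obtain i j where z: "z = (i, j)" "i < d" "j < d" "i + j \<le> k" by auto
      then obtain r where "r < mdim k" "monomials k ! r = (i, j)"
        using monomials_index by blast
      then show "z \<in> (!) (monomials k) ` ?I"
        using z by (auto simp: box_def image_iff intro!: exI [of _ r])
    next
      fix z assume "z \<in> (!) (monomials k) ` ?I"
      then show "z \<in> {(i, j). i < d \<and> j < d \<and> i + j \<le> k}"
        using nth_monomials_degree [of _ k] by (force simp: box_def)
    qed
    ultimately show "bij_betw ((!) (monomials k)) ?I {(i, j). i < d \<and> j < d \<and> i + j \<le> k}"
      by simp
  qed
  finally show ?thesis by (simp add: mat_rank_def)
qed

end

section \<open>Unique extensions along the grid sequence\<close>

lemma moment_extension_Suc: "moment_extension k (moment_matrix k \<beta>) (moment_matrix (Suc k) \<beta>)"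
  by (auto simp: moment_extension_def)

text \<open>Range inclusion and persistence of relations both follow from positivity of the larger
  matrix.\<close>

lemma grid_RG_extension:
  "RG_extension k (moment_matrix k (grid_moments d)) (moment_matrix (Suc k) (grid_moments d))"
  unfolding RG_extension_def
  using psd_extension_kernel [OF moment_extension_Suc grid_psd]
  by (auto simp: moment_extension_Suc grid_psd grid_recursively_generated intro: mat_range_block_B [THEN subsetD])

lemma grid_psd_RG_extension:
  "psd_RG_moment_extension k (moment_matrix k (grid_moments d)) (moment_matrix (Suc k) (grid_moments d))"
  by (simp add: psd_RG_moment_extension_def moment_extension_Suc grid_psd grid_recursively_generated)

text \<open>An extension of either kind is a candidate for the grid relations, and so is the next
  grid matrix; \<open>algorithm_candidate_unique\<close> identifies them.\<close>

lemma grid_extension_unique: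
  assumes "1 \<le> d" "d \<le> k"
    and N: "psd_RG_moment_extension k (moment_matrix k (grid_moments d)) N \<or>
      RG_extension k (moment_matrix k (grid_moments d)) N"
  shows "N = moment_matrix (Suc k) (grid_moments d)"
proof -
  obtain c where c: "\<And>s. s < d \<Longrightarrow> real s ^ d = (\<Sum>i<d. c i * real s ^ i)"
    using power_on_grid by blast
  note shape = grid_relation_shape [OF \<open>1 \<le> d\<close> c \<open>d \<le> k\<close>]
  let ?M = "moment_matrix k (grid_moments d)"
  have "poly_col k ?M (xy d 0 - x_lower d c) = 0\<^sub>v (mdim k)" "poly_col k ?M (xy 0 d - y_lower d c) = 0\<^sub>v (mdim k)"
    using x_relation_in_polys_upto [OF shape] y_relation_in_polys_upto [OF shape]
      peval_x_relation [OF assms(1) c] peval_y_relation [OF assms(1) c]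
    by (simp_all add: grid_poly_col_eq_0_iff)
  then have "algorithm_candidate k d d (x_lower d c) (y_lower d c) ?M N'"
    if "psd_RG_moment_extension k ?M N' \<or> RG_extension k ?M N'" for N'
    using extension_is_candidate [OF shape] that by blast
  then show ?thesis
    using algorithm_candidate_unique [OF shape] N grid_RG_extension by blast
qed

text \<open>Here \<open>p\<close> and \<open>q\<close> are any generators at level \<open>d\<close>,
  not just the lower parts constructed above. Their relations mean vanishing on the grid and
  therefore hold at each level \<open>k\<close>.\<close>

lemma grid_algorithm_step:
  assumes "1 \<le> d" "d \<le> k" and G: "G_generated d n m p q (moment_matrix d (grid_moments d))"
  shows "algorithm_step k n m p q (moment_matrix k (grid_moments d))
    (moment_matrix (Suc k) (grid_moments d))"
proof -
  let ?M = "\<lambda>k. moment_matrix k (grid_moments d)"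
  have shape_d: "relation_shape d n m p q" using G by (simp add: G_generated_def)
  then have shape: "relation_shape k n m p q"
    using assms(2) by (auto simp: relation_shape_def)
  have bounds: "1 \<le> n" "n \<le> d" "1 \<le> m" "m \<le> d" by (rule relation_bounds [OF shape_d])+
  \<comment> \<open>The multiplier \<open>xy 0 0 = 1\<close> exhibits the relations themselves among
    the generators.\<close>
  have "coeff_vec d (xy 0 0 * (xy n 0 - p)) \<in> mat_kernel (?M d)"
    "coeff_vec d (xy 0 0 * (xy 0 m - q)) \<in> mat_kernel (?M d)"
    using G bounds unfolding G_generated_def by (auto intro!: vspan_base exI [of _ 0])
  moreover have "xy 0 0 = 1" by (simp add: xy_def zero_prod_def [symmetric])
  ultimately have "poly_col d (?M d) (xy n 0 - p) = 0\<^sub>v (mdim d)"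
    "poly_col d (?M d) (xy 0 m - q) = 0\<^sub>v (mdim d)"
    by (auto simp: poly_col_def dest: mat_kernelD [OF moment_matrix_carrier])
  then have vanish: "\<forall>s<d. \<forall>t<d. peval (real s) (real t) (xy n 0 - p) = 0"
    "\<forall>s<d. \<forall>t<d. peval (real s) (real t) (xy 0 m - q) = 0"
    using x_relation_in_polys_upto [OF shape_d] y_relation_in_polys_upto [OF shape_d]
    by (auto simp: grid_poly_col_eq_0_iff)
  then have x: "poly_col k (?M k) (xy n 0 - p) = 0\<^sub>v (mdim k)"
    and y: "poly_col k (?M k) (xy 0 m - q) = 0\<^sub>v (mdim k)"
    using x_relation_in_polys_upto [OF shape] y_relation_in_polys_upto [OF shape]
    by (auto simp: grid_poly_col_eq_0_iff)
  have p: "p \<in> polys_upto k" and q: "q \<in> polys_upto k"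
    using polys_upto_mono [OF relation_p [OF shape]] polys_upto_mono [OF relation_q [OF shape]]
      bounds assms(2) by auto
  have "algorithm_candidate k n m p q (?M k) (?M (Suc k))"
    using extension_is_candidate [OF shape x y] grid_RG_extension by blast
  then have "\<forall>N'. algorithm_candidate k n m p q (?M k) N' \<longleftrightarrow> N' = ?M (Suc k)"
    using algorithm_candidate_unique [OF shape] by blast
  then show ?thesis
    using shape x y p q bounds assms(2)
    by (simp add: algorithm_step_def grid_psd grid_recursively_generated poly_col_diff_eq_0_iff)
qed

theorem theorem2p5:
  fixes d :: nat
  assumes "1 \<le> d"
  shows "\<exists>(\<beta> :: nat \<times> nat \<Rightarrow> real) (M :: nat \<Rightarrow> real mat).
    (\<forall>j. M j = moment_matrix j \<beta>) \<and>
    condition_G d (M d) \<and>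
    (\<forall>j. d \<le> j \<and> j \<le> 2 * d - 2 \<longrightarrow>
       (\<forall>N. psd_RG_moment_extension j (M j) N \<longleftrightarrow> N = M (j + 1))) \<and>
    (\<forall>n m p q. G_generated d n m p q (M d) \<longrightarrow>
       (\<forall>j. d \<le> j \<and> j \<le> 2 * d - 2 \<longrightarrow> algorithm_step j n m p q (M j) (M (j + 1)))) \<and>
    mat_rank (M (2 * d - 1)) = mat_rank (M (2 * d - 2)) \<and>
    (\<forall>j. d + 1 \<le> j \<and> j \<le> 2 * d - 2 \<longrightarrow> mat_rank (M j) > mat_rank (M (j - 1))) \<and>
    (\<forall>i. i \<le> d - 1 \<longrightarrow>
       condition_G (d + i) (M (d + i)) \<and>
       (\<exists>!N. RG_extension (d + i) (M (d + i)) N) \<and>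
       (i < d - 1 \<longrightarrow> RG_extension (d + i) (M (d + i)) (M (d + i + 1))) \<and>
       (\<forall>N. psd_RG_moment_extension (d + i) (M (d + i)) N \<longleftrightarrow>
            RG_extension (d + i) (M (d + i)) N \<and> psd N))"
proof -
  define M where "M j = moment_matrix j (grid_moments d)" for j
  obtain c where c: "\<And>s. s < d \<Longrightarrow> real s ^ d = (\<Sum>i<d. c i * real s ^ i)"
    using power_on_grid by blast
  have G: "condition_G j (M j)" if "d \<le> j" for j
    using grid_G_generated [OF assms c that] unfolding condition_G_def M_def by blast
  have psd_iff: "psd_RG_moment_extension j (M j) N \<longleftrightarrow> N = M (j + 1)" if "d \<le> j" for j N
    using grid_extension_unique [OF assms that] grid_psd_RG_extension by (auto simp: M_def)
  have RG_iff: "RG_extension j (M j) N \<longleftrightarrow> N = M (j + 1)" if "d \<le> j" for j N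
    using grid_extension_unique [OF assms that] grid_RG_extension by (auto simp: M_def)
  have step: "algorithm_step j n m p q (M j) (M (j + 1))"
    if "G_generated d n m p q (M d)" "d \<le> j" for n m p q j
    using grid_algorithm_step [OF assms that(2)] that(1) by (simp add: M_def)
  have psd: "psd (M j)" for j
    by (simp add: M_def grid_psd)
  have rank: "mat_rank (M j) = card {(u, v). u < d \<and> v < d \<and> u + v \<le> j}" for j
    unfolding M_def by (rule grid_rank [OF assms c])
  \<comment> \<open>The largest degree in the box is \<open>2 * d - 2\<close>, attained at the
    corner with both exponents \<open>d - 1\<close>.\<close>
  have "{(u, v). u < d \<and> v < d \<and> u + v \<le> 2 * d - 1} = {(u, v). u < d \<and> v < d \<and> u + v \<le> 2 * d - 2}"
    by auto
  then have flat: "mat_rank (M (2 * d - 1)) = mat_rank (M (2 * d - 2))"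
    by (simp only: rank)
  have growth: "mat_rank (M (j - 1)) < mat_rank (M j)" if "d + 1 \<le> j" "j \<le> 2 * d - 2" for j
    unfolding rank
  proof (rule psubset_card_mono)
    show "finite {(u, v). u < d \<and> v < d \<and> u + v \<le> j}"
      by (rule finite_subset [of _ "{..<d} \<times> {..<d}"]) auto
    \<comment> \<open>A box monomial of degree exactly \<open>j\<close>: the bound
      \<open>j \<le> 2 * d - 2\<close> keeps its second exponent below \<open>d\<close>.\<close>
    have "(d - 1, j - (d - 1)) \<in> {(u, v). u < d \<and> v < d \<and> u + v \<le> j}"
      "(d - 1, j - (d - 1)) \<notin> {(u, v). u < d \<and> v < d \<and> u + v \<le> j - 1}"
      using that by auto
    moreover have "{(u, v). u < d \<and> v < d \<and> u + v \<le> j - 1} \<subseteq> {(u, v). u < d \<and> v < d \<and> u + v \<le> j}"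
      by auto
    ultimately show "{(u, v). u < d \<and> v < d \<and> u + v \<le> j - 1} \<subset> {(u, v). u < d \<and> v < d \<and> u + v \<le> j}"
      by blast
  qed
  show ?thesis
    using step flat growth
    by (intro exI [of _ "grid_moments d"] exI [of _ M])
      (auto simp: psd_iff RG_iff G psd M_def [symmetric])
qed

end
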